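(* (1) Let $n=1$. Then, for every $y\in[1/C_\infty,1/C_0)$, as $\omega\to+\infty$, $$N(\omega,y)\sim\frac{\omega}{\pi}|\tilde\nu_1(y)|\widetilde T_1.$$ (2) Let $n=2$. Then, for every $y\in[1/C_\infty,1/C_0)$, as $\omega\to+\infty$, $$N(\omega,y)\sim\frac{\omega}{\pi}|\tilde\nu_1(y)|\widetilde T_1\quad\text{if } y\in[1/\widetilde C_2,1/C_0),$$ $$N(\omega,y)\sim\frac{\omega}{\pi}\left(|\tilde\nu_1(y)|\widetilde T_1+|\tilde\nu_2(y)|\widetilde T_2\right)\quad\text{if } y\in[1/C_\infty,1/\widetilde C_2).$$ (3) Let $n\geq3$ and assume $C_0<\widetilde C_2$. Then, for every $y\in[1/\widetilde C_2,1/C_0)$, as $\omega\to+\infty$, $$N(\omega,y)\sim\frac{\omega}{\pi}|\tilde\nu_1(y)|\widetilde T_1.$$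
   Context: Medium. Let $n\geq1$ be an integer, $0=H_1<H_2<\dots<H_{n+1}<H_{n+2}=+\infty$, $T_j=H_{j+1}-H_j\in(0,+\infty]$, and $\mu_j,\rho_j>0$ for $1\leq j\leq n+1$. Put $C_j=\sqrt{\mu_j/\rho_j}$, $C_0=\min_{1\leq j\leq n+1}C_j$, $C_\infty=C_{n+1}$. Standing assumption: $C_0<C_\infty$. Square roots: the square root of a nonnegative number is the nonnegative one and $\sqrt{-a}=-i\sqrt a$ for $a>0$. Put $\bar\nu_j(y)=\sqrt{y^2-C_j^{-2}}$. Reordering. Let $\sigma$ be a permutation of $\{1,\dots,n+1\}$ such that $\widetilde C_j:=C_{\sigma(j)}$ is nondecreasing in $j$; put $\tilde\nu_j:=\bar\nu_{\sigma(j)}$ and $\widetilde T_j:=T_{\sigma(j)}$. Dispersion function. For $\omega>0$ and real $k$, let $\nu_j=\nu_j(\omega,k)=\omega\sqrt{k^2\omega^{-2}-C_j^{-2}}$. Define $P_0=1$, $Q_0=0$ and, for $1\leq m\leq n$, $\begin{pmatrix}P_m\\Q_m\end{pmatrix}=M_m\begin{pmatrix}P_{m-1}\\Q_{m-1}\end{pmatrix}$, where $M_m=\begin{pmatrix}\cosh(\nu_mT_m)&\sinh(\nu_mT_m)/(\mu_m\nu_m)\\ \mu_m\nu_m\sinh(\nu_mT_m)&\cosh(\nu_mT_m)\end{pmatrix}$ if $\nu_m\neq0$ and $M_m=\begin{pmatrix}1&T_m/\mu_m\\0&1\end{pmatrix}$ if $\nu_m=0$. Set $f_n(\omega,k)=\mu_{n+1}\nu_{n+1}P_n+Q_n$.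 Branches. For $\omega>0$, $k_1(\omega)>k_2(\omega)>\cdots$ denote, in decreasing order, the (finitely many) values $k\in[\omega/C_\infty,\omega/C_0)$ with $f_n(\omega,k)=0$; $k_\ell(\omega)=-\infty$ by convention if there are fewer than $\ell$ such values. For $y\in[1/C_\infty,1/C_0)$, $N(\omega,y):=\#\{\ell\geq1: k_\ell(\omega)/\omega\geq y\}$. $a(\omega)\sim b(\omega)$ means $a(\omega)/b(\omega)\to1$. *)

theory Defs
  imports "HOL-Analysis.Analysis" "HOL-Combinatorics.Permutations" "HOL-Library.Landau_Symbols"
begin

text \<open>
  A layered medium is given by \<open>n\<close>, the interface depths \<open>H\<close> and the parameters \<open>\<mu>\<close>, \<open>\<rho>\<close>, with
  layers indexed by \<open>1, \<dots>, n+1\<close>; the last one is the half-space. Values outside these index ranges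
  are never used.
\<close>

definition wave_speed :: "(nat \<Rightarrow> real) \<Rightarrow> (nat \<Rightarrow> real) \<Rightarrow> nat \<Rightarrow> real" where
  "wave_speed \<mu> \<rho> j = sqrt (\<mu> j / \<rho> j)"

definition min_speed :: "nat \<Rightarrow> (nat \<Rightarrow> real) \<Rightarrow> (nat \<Rightarrow> real) \<Rightarrow> real" where
  "min_speed n \<mu> \<rho> = Min (wave_speed \<mu> \<rho> ` {1..n+1})"

definition speed_infinity :: "nat \<Rightarrow> (nat \<Rightarrow> real) \<Rightarrow> (nat \<Rightarrow> real) \<Rightarrow> real" where
  "speed_infinity n \<mu> \<rho> = wave_speed \<mu> \<rho> (n+1)"

definition thickness :: "(nat \<Rightarrow> ereal) \<Rightarrow> nat \<Rightarrow> ereal" where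
  "thickness H j = H (j+1) - H j"

definition layered_medium ::
    "nat \<Rightarrow> (nat \<Rightarrow> ereal) \<Rightarrow> (nat \<Rightarrow> real) \<Rightarrow> (nat \<Rightarrow> real) \<Rightarrow> bool" where
  "layered_medium n H \<mu> \<rho> \<longleftrightarrow>
     1 \<le> n \<and> H 1 = 0 \<and> (\<forall>j\<in>{1..n+1}. H j < H (j+1)) \<and> H (n+2) = \<infinity> \<and>
     (\<forall>j\<in>{1..n+1}. 0 < \<mu> j \<and> 0 < \<rho> j)"

text \<open>
  On negative reals this branch is the opposite of \<^const>\<open>csqrt\<close>.
\<close>
definition branch_sqrt :: "real \<Rightarrow> complex" where
  "branch_sqrt x = (if 0 \<le> x then of_real (sqrt x) else - \<i> * of_real (sqrt (- x)))"

definition nu_bar :: "(nat \<Rightarrow> real) \<Rightarrow> (nat \<Rightarrow> real) \<Rightarrow> nat \<Rightarrow> real \<Rightarrow> complex" where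
  "nu_bar \<mu> \<rho> j y = branch_sqrt (y\<^sup>2 - 1 / (wave_speed \<mu> \<rho> j)\<^sup>2)"

definition nu :: "(nat \<Rightarrow> real) \<Rightarrow> (nat \<Rightarrow> real) \<Rightarrow> nat \<Rightarrow> real \<Rightarrow> real \<Rightarrow> complex" where
  "nu \<mu> \<rho> j \<omega> k = of_real \<omega> * branch_sqrt (k\<^sup>2 / \<omega>\<^sup>2 - 1 / (wave_speed \<mu> \<rho> j)\<^sup>2)"

text \<open>
  Only used for \<open>1 \<le> m \<le> n\<close>, where the thickness is finite, so that \<^const>\<open>real_of_ereal\<close> loses nothing.
\<close>
definition transfer_matrix ::
    "(nat \<Rightarrow> ereal) \<Rightarrow> (nat \<Rightarrow> real) \<Rightarrow> (nat \<Rightarrow> real) \<Rightarrow> nat \<Rightarrow> real \<Rightarrow> real \<Rightarrow> complex^2^2" where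
  "transfer_matrix H \<mu> \<rho> m \<omega> k =
     (let \<nu> = nu \<mu> \<rho> m \<omega> k;
          T = complex_of_real (real_of_ereal (thickness H m));
          c = complex_of_real (\<mu> m)
      in if \<nu> \<noteq> 0
         then vector [vector [cosh (\<nu> * T), sinh (\<nu> * T) / (c * \<nu>)],
                      vector [c * \<nu> * sinh (\<nu> * T), cosh (\<nu> * T)]]
         else vector [vector [1, T / c],
                      vector [0, 1]])"

text \<open>The vector with components \<open>P\<^sub>m\<close> and \<open>Q\<^sub>m\<close>.\<close>
primrec PQ ::
    "(nat \<Rightarrow> ereal) \<Rightarrow> (nat \<Rightarrow> real) \<Rightarrow> (nat \<Rightarrow> real) \<Rightarrow> real \<Rightarrow> real \<Rightarrow> nat \<Rightarrow> complex^2" where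
  "PQ H \<mu> \<rho> \<omega> k 0 = vector [1, 0]"
| "PQ H \<mu> \<rho> \<omega> k (Suc m) = transfer_matrix H \<mu> \<rho> (Suc m) \<omega> k *v PQ H \<mu> \<rho> \<omega> k m"

definition dispersion ::
    "nat \<Rightarrow> (nat \<Rightarrow> ereal) \<Rightarrow> (nat \<Rightarrow> real) \<Rightarrow> (nat \<Rightarrow> real) \<Rightarrow> real \<Rightarrow> real \<Rightarrow> complex" where
  "dispersion n H \<mu> \<rho> \<omega> k =
     of_real (\<mu> (n+1)) * nu \<mu> \<rho> (n+1) \<omega> k * PQ H \<mu> \<rho> \<omega> k n $ 1 + PQ H \<mu> \<rho> \<omega> k n $ 2"

definition wavenumbers ::
    "nat \<Rightarrow> (nat \<Rightarrow> ereal) \<Rightarrow> (nat \<Rightarrow> real) \<Rightarrow> (nat \<Rightarrow> real) \<Rightarrow> real \<Rightarrow> real set" where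
  "wavenumbers n H \<mu> \<rho> \<omega> =
     {k \<in> {\<omega> / speed_infinity n \<mu> \<rho> ..< \<omega> / min_speed n \<mu> \<rho>}. dispersion n H \<mu> \<rho> \<omega> k = 0}"

text \<open>
  The \<open>l\<close>-th largest element of \<^const>\<open>wavenumbers\<close>, for \<open>l \<ge> 1\<close>. If that set were infinite, all
  branches would be \<open>-\<infinity>\<close> and the counting function below would vanish; hence an asymptotic
  equivalence of the counting function with a positive function contains the eventual finiteness.
\<close>
definition branch ::
    "nat \<Rightarrow> (nat \<Rightarrow> ereal) \<Rightarrow> (nat \<Rightarrow> real) \<Rightarrow> (nat \<Rightarrow> real) \<Rightarrow> nat \<Rightarrow> real \<Rightarrow> ereal" where
  "branch n H \<mu> \<rho> l \<omega> =
     (if l \<le> card (wavenumbers n H \<mu> \<rho> \<omega>)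
      then ereal (rev (sorted_list_of_set (wavenumbers n H \<mu> \<rho> \<omega>)) ! (l - 1))
      else -\<infinity>)"

definition counting ::
    "nat \<Rightarrow> (nat \<Rightarrow> ereal) \<Rightarrow> (nat \<Rightarrow> real) \<Rightarrow> (nat \<Rightarrow> real) \<Rightarrow> real \<Rightarrow> real \<Rightarrow> nat" where
  "counting n H \<mu> \<rho> \<omega> y = card {l. 1 \<le> l \<and> ereal y \<le> branch n H \<mu> \<rho> l \<omega> / ereal \<omega>}"

definition speed_ordering ::
    "nat \<Rightarrow> (nat \<Rightarrow> real) \<Rightarrow> (nat \<Rightarrow> real) \<Rightarrow> (nat \<Rightarrow> nat) \<Rightarrow> bool" where
  "speed_ordering n \<mu> \<rho> \<sigma> \<longleftrightarrow>
     \<sigma> permutes {1..n+1} \<and> mono_on {1..n+1} (\<lambda>j. wave_speed \<mu> \<rho> (\<sigma> j))"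

text \<open>
  The contribution \<open>|\<nu>\<^sub>j(y)| T\<^sub>j\<close> of layer \<open>j\<close> to the leading coefficient. It is to be used only for
  \<open>j \<le> n\<close>, as \<^const>\<open>real_of_ereal\<close> sends \<open>\<infinity>\<close> to \<open>0\<close>. This is the case for the layer \<open>\<sigma>(1)\<close>
  when the minimal speed is less than that of the half-space, and for \<open>\<sigma>(2)\<close> when its speed is.
\<close>
definition layer_phase ::
    "(nat \<Rightarrow> ereal) \<Rightarrow> (nat \<Rightarrow> real) \<Rightarrow> (nat \<Rightarrow> real) \<Rightarrow> nat \<Rightarrow> real \<Rightarrow> real" where
  "layer_phase H \<mu> \<rho> j y = cmod (nu_bar \<mu> \<rho> j y) * real_of_ereal (thickness H j)"

end

theory Submission
  imports Defs "HOL-Real_Asymp.Real_Asymp"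
begin

text \<open>
  The proof is a Sturm oscillation argument by means of a Pruefer angle. Put \<open>y = k / \<omega>\<close>. The pair
  \<open>(P\<^sub>m, Q\<^sub>m)\<close> is real: it consists of the displacement and the traction, at the bottom of layer
  \<open>m\<close>, of the solution of the wave equation that is stress free at the surface. Read it as a point of
  the plane and let \<open>\<theta>\<^sub>m(y)\<close> be a continuous choice of its polar angle. The dispersion function is a
  positive multiple of \<open>sin (\<theta>\<^sub>n(y) + arctan (\<mu>\<^sub>n\<^sub>+\<^sub>1 |\<nu>\<^sub>n\<^sub>+\<^sub>1|))\<close>, so the modes with \<open>k / \<omega> \<ge> y\<close>
  are the parameters in \<open>[y, 1/C\<^sub>0)\<close> at which this total angle is a multiple of \<open>\<pi>\<close>.
  
  The total angle is strictly increasing in \<open>y\<close>. The Wronskian-type quantity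
  \<open>P \<partial>\<^sub>yQ - Q \<partial>\<^sub>yP\<close> gains in each layer a positive definite quadratic form in the incoming state
  (\<open>layer_map_DERIV_cross\<close>), and the half-space term is increasing as well. Hence the set of modes is
  finite, and their number is, up to \<open>1\<close>, the increase of the total angle divided by \<open>\<pi>\<close>
  (\<open>card_multiples_pi_crossed\<close>).
  
  The increase of the angle is known up to a constant that depends on \<open>n\<close> only. A layer acts
  linearly with determinant one, so, up to \<open>2\<pi>\<close>, the change of the angle that it causes varies with \<open>y\<close>
  in the same way as the angle of the image of the vector \<open>(1, 0)\<close> (\<open>arg_lift_layer_variation\<close>). The
  latter is, again up to \<open>2\<pi>\<close>, the clockwise rotation by \<open>\<omega> |\<nu>\<^sub>j(y)| T\<^sub>j\<close> if the layer is oscillating,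
  that is \<open>y < 1/C\<^sub>j\<close>, and zero otherwise (\<open>arg_lift_reference_variation\<close>). At \<open>y = 1/C\<^sub>0\<close> no
  layer oscillates.
  
  Thus, for every number of layers and every admissible \<open>y\<close>, \<open>\<pi> N(\<omega>, y)\<close> differs from
  \<open>\<omega> \<Sum> |\<nu>\<^sub>j(y)| T\<^sub>j\<close>, the sum over the finite layers with \<open>C\<^sub>j < 1/y\<close>, by at most a constant
  (\<open>counting_bounded_error\<close>). The assertions of the theorem are the cases in which the ordering of the
  speeds shows that the sum consists of the slowest layer only or, for \<open>n = 2\<close> and small \<open>y\<close>, of the two
  slowest ones.
\<close>

section \<open>The entire functions behind the transfer matrices\<close>

text \<open>
  \<open>cosh_root x\<close> and \<open>sinhc_root x\<close> are \<open>cosh \<surd>x\<close> and \<open>sinh \<surd>x / \<surd>x\<close>, continued to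
  negative \<open>x\<close>. They are entire in \<open>x\<close>, so they describe evanescent and oscillating layers at once and
  keep the transfer matrices real whatever the branch of the square root.
\<close>
definition cosh_root :: "real \<Rightarrow> real" where
  "cosh_root x = (if x \<ge> 0 then cosh (sqrt x) else cos (sqrt (- x)))"

definition sinhc_root :: "real \<Rightarrow> real" where
  "sinhc_root x =
     (if x = 0 then 1 else if x > 0 then sinh (sqrt x) / sqrt x else sin (sqrt (- x)) / sqrt (- x))"

lemma cosh_sinhc_root_det: "(cosh_root x)\<^sup>2 - x * (sinhc_root x)\<^sup>2 = 1"
proof -
  consider "x = 0" | "x > 0" | "x < 0" by linarith
  then show ?thesis
  proof cases
    case 2
    then have "x * (sinh (sqrt x) / sqrt x)\<^sup>2 = (sinh (sqrt x))\<^sup>2"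
      by (simp add: power_divide)
    with 2 show ?thesis
      by (simp add: cosh_root_def sinhc_root_def cosh_square_eq)
  next
    case 3
    then have "x * (sin (sqrt (- x)) / sqrt (- x))\<^sup>2 = - (sin (sqrt (- x)))\<^sup>2"
      by (simp add: power_divide)
    with 3 show ?thesis
      by (simp add: cosh_root_def sinhc_root_def)
  qed (simp add: cosh_root_def sinhc_root_def)
qed

lemma isCont_cosh_root: "isCont cosh_root x"
proof -
  have "continuous_on ({0..} \<union> {..0}) (\<lambda>x. if x \<ge> 0 then cosh (sqrt x) else cos (sqrt (- x)))"
    by (rule continuous_on_If) (auto intro!: continuous_intros)
  moreover have "{0..} \<union> {..0} = (UNIV :: real set)" by auto
  ultimately show ?thesis
    by (simp add: cosh_root_def[abs_def] continuous_on_eq_continuous_at)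
qed

text \<open>
  The two derivative formulas also hold at \<open>0\<close> after continuation. The point \<open>0\<close> is left out because
  the angle is monotone across finitely many points where no derivative is known
  (\<open>strict_increasing_off_finite\<close>).
\<close>
lemma DERIV_cosh_root:
  assumes "x \<noteq> 0"
  shows "(cosh_root has_real_derivative sinhc_root x / 2) (at x)"
proof (cases "x > 0")
  case True
  have "((\<lambda>x. cosh (sqrt x)) has_real_derivative sinhc_root x / 2) (at x)"
    by (rule derivative_eq_intros refl | use True in \<open>simp add: sinhc_root_def field_simps\<close>)+
  then show ?thesis
    by (rule has_field_derivative_transform_within_open[of _ _ _ "{0<..}"])
       (use True in \<open>auto simp: cosh_root_def\<close>)
next
  case False
  have "((\<lambda>x. cos (sqrt (- x))) has_real_derivative sinhc_root x / 2) (at x)"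
    by (rule derivative_eq_intros refl | use False assms in \<open>simp add: sinhc_root_def field_simps\<close>)+
  then show ?thesis
    by (rule has_field_derivative_transform_within_open[of _ _ _ "{..<0}"])
       (use False assms in \<open>auto simp: cosh_root_def\<close>)
qed

lemma DERIV_sinhc_root:
  assumes "x \<noteq> 0"
  shows "(sinhc_root has_real_derivative (cosh_root x - sinhc_root x) / (2 * x)) (at x)"
proof (cases "x > 0")
  case True
  have "((\<lambda>x. sinh (sqrt x) / sqrt x) has_real_derivative (cosh_root x - sinhc_root x) / (2 * x)) (at x)"
    by (rule derivative_eq_intros refl | use True in \<open>simp add: sinhc_root_def cosh_root_def field_simps\<close>)+
  then show ?thesis
    by (rule has_field_derivative_transform_within_open[of _ _ _ "{0<..}"])
       (use True in \<open>auto simp: sinhc_root_def\<close>)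
next
  case False
  have "((\<lambda>x. sin (sqrt (- x)) / sqrt (- x)) has_real_derivative (cosh_root x - sinhc_root x) / (2 * x)) (at x)"
    by (rule derivative_eq_intros refl | use False assms in \<open>simp add: sinhc_root_def cosh_root_def field_simps\<close>)+
  then show ?thesis
    by (rule has_field_derivative_transform_within_open[of _ _ _ "{..<0}"])
       (use False assms in \<open>auto simp: sinhc_root_def\<close>)
qed

lemma isCont_sinhc_root: "isCont sinhc_root x"
proof (cases "x = 0")
  case False
  then show ?thesis using DERIV_sinhc_root DERIV_isCont by blast
next
  case True
  have 1: "((\<lambda>x. sinh (sqrt x) / sqrt x :: real) \<longlongrightarrow> 1) (at_right 0)"
    by real_asymp
  have 2: "((\<lambda>x. sin (sqrt (- x)) / sqrt (- x) :: real) \<longlongrightarrow> 1) (at_left 0)"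
    by real_asymp
  have "(sinhc_root \<longlongrightarrow> 1) (at_right 0)"
    using 1 by (rule Lim_transform_eventually)
       (auto simp: eventually_at_right_field sinhc_root_def intro!: exI[of _ 1])
  moreover have "(sinhc_root \<longlongrightarrow> 1) (at_left 0)"
    using 2 by (rule Lim_transform_eventually)
       (auto simp: eventually_at_left_field sinhc_root_def intro!: exI[of _ "-1"])
  ultimately have "(sinhc_root \<longlongrightarrow> 1) (at 0)"
    using filterlim_split_at by blast
  then show ?thesis using True by (simp add: isCont_def sinhc_root_def)
qed

lemma sin_less_self:
  fixes x :: real
  assumes "x > 0"
  shows "sin x < x"
proof (cases "x < pi")
  case True
  have "\<exists>z. 0 < z \<and> z < x \<and> sin x - sin 0 = (x - 0) * cos z"
    using assms by (intro MVT2) (auto intro!: derivative_eq_intros)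
  then obtain z where z: "0 < z" "z < x" "sin x = x * cos z" by auto
  then have "cos z < 1"
    using cos_monotone_0_pi[of 0 z] True by simp
  with z assms show ?thesis by simp
next
  case False
  then show ?thesis using sin_le_one[of x] pi_gt3 by linarith
qed

lemma sinh_greater_self:
  fixes x :: real
  assumes "x > 0"
  shows "x < sinh x"
proof -
  have "\<exists>z. 0 < z \<and> z < x \<and> sinh x - sinh 0 = (x - 0) * cosh z"
    using assms by (intro MVT2) (auto intro!: derivative_eq_intros)
  then obtain z where z: "0 < z" "sinh x = x * cosh z" by auto
  have "cosh z > 1"
    using z(1) cosh_real_strict_mono[of 0 z] by simp
  with z assms show ?thesis by simp
qed

lemma sinhc_root_gt_1: "x > 0 \<Longrightarrow> sinhc_root x > 1"
  using sinh_greater_self[of "sqrt x"] by (simp add: sinhc_root_def)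

lemma sinhc_root_square_lt_1:
  assumes "x < 0" shows "(sinhc_root x)\<^sup>2 < 1"
proof -
  let ?k = "sqrt (- x)"
  have k: "?k > 0" using assms by simp
  have "\<bar>sin ?k\<bar> < ?k"
    using k sin_less_self[of ?k] sin_ge_zero[of ?k] sin_ge_minus_one[of ?k] pi_gt3 by linarith
  then have "\<bar>sinhc_root x\<bar> < 1"
    using assms k by (simp add: sinhc_root_def)
  then show ?thesis by (simp add: abs_square_less_1)
qed

text \<open>
  With \<open>\<kappa> = \<surd>\<bar>x\<bar>\<close> the products here are \<open>sinh (2\<kappa>) / (2\<kappa>)\<close> and \<open>sin (2\<kappa>) / (2\<kappa>)\<close>. The bounds
  make the leading coefficient in \<open>layer_quadratic_form_pos\<close> positive.
\<close>
lemma sinhc_cosh_root_gt_1: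
  assumes "x > 0" shows "sinhc_root x * cosh_root x > 1"
proof -
  have "cosh_root x \<ge> 1" using assms by (simp add: cosh_root_def cosh_real_ge_1)
  then show ?thesis
    using sinhc_root_gt_1[OF assms] by (smt (verit) mult_le_cancel_left1)
qed

lemma sinhc_cosh_root_abs_lt_1:
  assumes "x < 0" shows "\<bar>sinhc_root x * cosh_root x\<bar> < 1"
proof -
  have "\<bar>cosh_root x\<bar> \<le> 1" using assms by (simp add: cosh_root_def)
  moreover have "\<bar>sinhc_root x\<bar> < 1"
    using sinhc_root_square_lt_1[OF assms] by (simp add: abs_square_less_1)
  ultimately show ?thesis
    using mult_left_le[of "\<bar>cosh_root x\<bar>" "\<bar>sinhc_root x\<bar>"] by (simp add: abs_mult)
qed

section \<open>Action of one layer on displacement and traction\<close>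

text \<open>
  The transfer matrix of a layer in real form, acting on the state \<open>P + \<i> Q\<close>. The parameters are the
  compliance \<open>t = T / \<mu>\<close> and the number \<open>x = (\<nu> T)\<^sup>2\<close>, which is negative when the layer oscillates.
\<close>
definition layer_map :: "real \<Rightarrow> real \<Rightarrow> complex \<Rightarrow> complex" where
  "layer_map t x v =
     Complex (cosh_root x * Re v + t * sinhc_root x * Im v)
             (x * sinhc_root x / t * Re v + cosh_root x * Im v)"

definition cross :: "complex \<Rightarrow> complex \<Rightarrow> real" where
  "cross u v = Re u * Im v - Im u * Re v"

lemma cross_layer_map:
  assumes "t \<noteq> 0"
  shows "cross (layer_map t x u) (layer_map t x v) = cross u v"
proof -
  have "cross (layer_map t x u) (layer_map t x v)
          = ((cosh_root x)\<^sup>2 - x * (sinhc_root x)\<^sup>2) * cross u v"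
    using assms by (simp add: cross_def layer_map_def field_simps power2_eq_square)
  then show ?thesis by (simp add: cosh_sinhc_root_det)
qed

lemma layer_map_nonzero:
  assumes "t \<noteq> 0" "v \<noteq> 0"
  shows "layer_map t x v \<noteq> 0"
proof
  assume "layer_map t x v = 0"
  \<comment> \<open>\<open>cross v (\<i> v)\<close> is the squared norm of \<open>v\<close>, and it survives the map\<close>
  then have "cross v (\<i> * v) = 0"
    using cross_layer_map[OF assms(1), of x v "\<i> * v"] by (simp add: cross_def)
  then have "(Re v)\<^sup>2 + (Im v)\<^sup>2 = 0" by (simp add: cross_def power2_eq_square)
  with assms(2) show False by (simp add: complex_neq_0)
qed

lemma continuous_layer_map:
  assumes "t \<noteq> 0" "isCont x y" "isCont v y"
  shows "isCont (\<lambda>y. layer_map t (x y) (v y)) y"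
proof -
  have "isCont (\<lambda>y. cosh_root (x y)) y" "isCont (\<lambda>y. sinhc_root (x y)) y"
    using assms isCont_cosh_root isCont_sinhc_root isCont_o2 by blast+
  then show ?thesis
    unfolding layer_map_def Complex_eq by (intro continuous_intros assms) (use assms in auto)
qed

section \<open>Continuous polar angles and their variation\<close>

definition arg_lift :: "real \<Rightarrow> real \<Rightarrow> (real \<Rightarrow> complex) \<Rightarrow> (real \<Rightarrow> real) \<Rightarrow> bool" where
  "arg_lift a b v \<theta> \<longleftrightarrow>
     continuous_on {a..b} \<theta> \<and> (\<forall>y\<in>{a..b}. \<exists>r>0. v y = rcis r (\<theta> y))"

lemma arg_liftE:
  assumes "arg_lift a b v \<theta>" "y \<in> {a..b}"
  obtains r where "r > 0" "Re (v y) = r * cos (\<theta> y)" "Im (v y) = r * sin (\<theta> y)"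
  using assms unfolding arg_lift_def by (metis Re_rcis Im_rcis)

text \<open>
  A zero-free continuous function on an interval has a continuous logarithm; its imaginary part is a
  polar angle.
\<close>
lemma arg_lift_exists:
  assumes "continuous_on {a..b} v" "\<And>y. y \<in> {a..b} \<Longrightarrow> v y \<noteq> 0"
  obtains \<theta> where "arg_lift a b v \<theta>"
proof -
  obtain g where g: "continuous_on {a..b} g" "\<And>y. y \<in> {a..b} \<Longrightarrow> v y = exp (g y)"
    using continuous_logarithm_on_contractible[OF assms(1) convex_imp_contractible] assms(2)
    by (metis convex_real_interval(5))
  have "arg_lift a b v (\<lambda>y. Im (g y))"
    unfolding arg_lift_def
  proof (intro conjI ballI)
    show "continuous_on {a..b} (\<lambda>y. Im (g y))" using g(1) by (intro continuous_intros)
    fix y assume "y \<in> {a..b}"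
    then have "v y = rcis (exp (Re (g y))) (Im (g y))"
      using g(2) by (simp add: exp_eq_polar rcis_def)
    then show "\<exists>r>0. v y = rcis r (Im (g y))" using exp_gt_zero by blast
  qed
  then show ?thesis using that by blast
qed

text \<open>
  The odd multiples of \<open>\<pi>\<close> cannot be crossed, so the function stays in one gap between two of them.
\<close>
lemma variation_lt_2pi:
  fixes h :: "real \<Rightarrow> real"
  assumes "a \<le> b" "continuous_on {a..b} h" "\<And>y. y \<in> {a..b} \<Longrightarrow> cos (h y) \<noteq> -1"
  shows "\<bar>h b - h a\<bar> < 2 * pi"
proof (rule ccontr)
  assume far: "\<not> ?thesis"
  define lo where "lo = min (h a) (h b)"
  define j where "j = \<lceil>(lo - pi) / (2 * pi)\<rceil>"
  \<comment> \<open>the least odd multiple of \<open>\<pi>\<close> that is at least the smaller end value\<close>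
  define c where "c = pi + 2 * pi * of_int j"
  have "(lo - pi) / (2 * pi) \<le> of_int j" "of_int j < (lo - pi) / (2 * pi) + 1"
    unfolding j_def by linarith+
  then have "lo \<le> c" "c \<le> lo + 2 * pi"
    by (simp_all add: c_def field_simps)
  with far have "h a \<le> c \<and> c \<le> h b \<or> h b \<le> c \<and> c \<le> h a"
    by (auto simp: lo_def min_def split: if_splits)
  then obtain y where "y \<in> {a..b}" "h y = c"
    using IVT'[of h a c b] IVT2'[of h b c a] assms by auto
  moreover have "cos c = -1"
    using cos_int_2pin[of j] by (simp add: c_def cos_add sin_int_2pin)
  ultimately show False using assms(3) by metis
qed

text \<open>
  The angles of an image \<open>L v\<close>, of \<open>L 1\<close> and of \<open>v\<close> never satisfy \<open>\<theta>' - \<phi> = \<theta> + \<pi>\<close> modulo \<open>2\<pi>\<close>: by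
  the invariance of \<^const>\<open>cross\<close>, \<open>sin (\<theta>' - \<phi>)\<close> and \<open>sin \<theta>\<close> have the same sign, and if both vanish
  then \<open>L v\<close> is the same multiple of \<open>L 1\<close> as \<open>v\<close> is of \<open>1\<close>. This allows the rotation of an arbitrary
  state to be read off from that of the fixed state \<open>1\<close>.
\<close>
lemma arg_lift_layer_variation:
  assumes "a \<le> b" "t > 0" "arg_lift a b v \<theta>" "arg_lift a b (\<lambda>y. layer_map t (x y) 1) \<phi>"
    and "arg_lift a b (\<lambda>y. layer_map t (x y) (v y)) \<theta>'"
  shows "\<bar>(\<theta>' b - \<theta>' a) - (\<phi> b - \<phi> a) - (\<theta> b - \<theta> a)\<bar> < 2 * pi"
proof -
  let ?h = "\<lambda>y. \<theta>' y - \<phi> y - \<theta> y"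
  have "\<bar>?h b - ?h a\<bar> < 2 * pi"
  proof (rule variation_lt_2pi[of a b ?h])
    show "continuous_on {a..b} ?h"
      using assms(3-5) unfolding arg_lift_def by (intro continuous_intros) auto
    fix y assume y: "y \<in> {a..b}"
    obtain r where r: "r > 0" "Re (v y) = r * cos (\<theta> y)" "Im (v y) = r * sin (\<theta> y)"
      using assms(3) y by (elim arg_liftE)
    obtain p where p: "p > 0" "Re (layer_map t (x y) 1) = p * cos (\<phi> y)"
        "Im (layer_map t (x y) 1) = p * sin (\<phi> y)"
      using assms(4) y by (elim arg_liftE)
    obtain q where q: "q > 0" "Re (layer_map t (x y) (v y)) = q * cos (\<theta>' y)"
        "Im (layer_map t (x y) (v y)) = q * sin (\<theta>' y)"
      using assms(5) y by (elim arg_liftE)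
    show "cos (?h y) \<noteq> -1"
    proof
      assume c: "cos (?h y) = -1"
      then have s: "sin (?h y) = 0" using sin_cos_squared_add[of "?h y"] by simp
      have "sin (?h y + \<theta> y) = - sin (\<theta> y)"
        unfolding sin_add c s by simp
      then have sd: "sin (\<theta>' y - \<phi> y) = - sin (\<theta> y)" by simp
      have "cos (?h y + \<theta> y) = - cos (\<theta> y)"
        unfolding cos_add c s by simp
      then have cd: "cos (\<theta>' y - \<phi> y) = - cos (\<theta> y)" by simp
      have "cross (layer_map t (x y) 1) (layer_map t (x y) (v y)) = p * q * sin (\<theta>' y - \<phi> y)"
        by (simp add: cross_def p q sin_diff algebra_simps)
      then have "r * sin (\<theta> y) = - (p * q) * sin (\<theta> y)"
        using cross_layer_map[of t "x y" 1 "v y"] assms(2) r by (simp add: sd cross_def)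
      then have "(r + p * q) * sin (\<theta> y) = 0" by (simp add: algebra_simps)
      moreover have "r + p * q > 0" using r p q by (intro add_pos_pos mult_pos_pos)
      ultimately have s0: "sin (\<theta> y) = 0" by simp
      then have "layer_map t (x y) (v y) = of_real (r * cos (\<theta> y)) * layer_map t (x y) 1"
        using r by (simp add: layer_map_def complex_eq_iff)
      then have e: "q * cos (\<theta>' y) = r * cos (\<theta> y) * (p * cos (\<phi> y))"
        "q * sin (\<theta>' y) = r * cos (\<theta> y) * (p * sin (\<phi> y))"
        using q p by (simp_all add: complex_eq_iff)
      have "q * cos (\<theta>' y - \<phi> y) = q * cos (\<theta>' y) * cos (\<phi> y) + q * sin (\<theta>' y) * sin (\<phi> y)"
        by (simp add: cos_diff distrib_left)
      also have "\<dots> = r * cos (\<theta> y) * p * ((cos (\<phi> y))\<^sup>2 + (sin (\<phi> y))\<^sup>2)"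
        unfolding e by (simp only: power2_eq_square distrib_left mult_ac)
      finally have "q * cos (\<theta>' y - \<phi> y) = r * cos (\<theta> y) * p" by simp
      then have "(q + r * p) * cos (\<theta> y) = 0" by (simp add: cd algebra_simps)
      moreover have "q + r * p > 0" using r p q by (intro add_pos_pos mult_pos_pos)
      ultimately have "cos (\<theta> y) = 0" by simp
      with s0 show False using sin_cos_squared_add[of "\<theta> y"] by simp
    qed
  qed fact
  then show ?thesis by (simp add: algebra_simps)
qed

text \<open>
  With \<open>\<kappa> = \<surd>(-x)\<close>, the image of \<open>1\<close> in an oscillating layer is \<open>(cos \<kappa>, - (\<kappa> / t) sin \<kappa>)\<close>, which lies
  in the same quadrant as \<open>(cos \<kappa>, - sin \<kappa>)\<close>; in an evanescent layer its first component is positive.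
  Therefore its angle always stays closer than a right angle to \<open>- \<kappa>\<close> or \<open>0\<close>, respectively, modulo
  \<open>2\<pi>\<close>.
\<close>
lemma arg_lift_reference_variation:
  assumes "a \<le> b" "t > 0" "continuous_on {a..b} x" "arg_lift a b (\<lambda>y. layer_map t (x y) 1) \<phi>"
  shows "\<bar>(\<phi> b - \<phi> a) + (sqrt (max 0 (- x b)) - sqrt (max 0 (- x a)))\<bar> < 2 * pi"
proof -
  let ?h = "\<lambda>y. \<phi> y + sqrt (max 0 (- x y))"
  have "\<bar>?h b - ?h a\<bar> < 2 * pi"
  proof (rule variation_lt_2pi[of a b ?h])
    show "continuous_on {a..b} ?h"
      using assms(3,4) unfolding arg_lift_def by (intro continuous_intros) auto
    fix y assume y: "y \<in> {a..b}"
    obtain p where p: "p > 0" "Re (layer_map t (x y) 1) = p * cos (\<phi> y)"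
        "Im (layer_map t (x y) 1) = p * sin (\<phi> y)"
      using assms(4) y by (elim arg_liftE)
    have "p * cos (?h y) > 0"
    proof (cases "x y < 0")
      case False
      then have "p * cos (\<phi> y) > 0"
        using p cosh_real_pos[of "sqrt (x y)"] by (simp add: layer_map_def cosh_root_def)
      then show ?thesis using False by (simp add: max_def)
    next
      case True
      define k where "k = sqrt (- x y)"
      have k: "k > 0" "x y = - (k * k)" using True by (simp_all add: k_def)
      have c: "p * cos (\<phi> y) = cos k"
        using p(2) True by (simp add: layer_map_def cosh_root_def k_def)
      have "p * sin (\<phi> y) = x y * (sin k / k) / t"
        using p(3) True by (simp add: layer_map_def sinhc_root_def k_def)
      then have s: "p * sin (\<phi> y) = - (k * sin k / t)"
        using k by simp
      have "p * cos (?h y) = (p * cos (\<phi> y)) * cos k - (p * sin (\<phi> y)) * sin k"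
        using True by (simp add: max_def cos_add k_def algebra_simps)
      also have "\<dots> = (cos k)\<^sup>2 + k / t * (sin k)\<^sup>2"
        unfolding c s by (simp add: power2_eq_square)
      also have "\<dots> > 0"
      proof (cases "sin k = 0")
        case True
        then show ?thesis using sin_cos_squared_add[of k] by simp
      next
        case False
        then have "k / t * (sin k)\<^sup>2 > 0" using k assms(2) by simp
        then show ?thesis by (simp add: add_nonneg_pos)
      qed
      finally show ?thesis .
    qed
    then have "cos (?h y) > 0" using p(1) by (simp add: zero_less_mult_iff)
    then show "cos (?h y) \<noteq> -1" by linarith
  qed fact
  then show ?thesis by (simp add: algebra_simps)
qed

section \<open>Monotone angles and the count of zeros\<close>

lemma strict_increasing_off_finite:
  fixes \<theta> :: "real \<Rightarrow> real"
  assumes "finite S" "a < b" "continuous_on {a..b} \<theta>"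
    and "\<And>y. a < y \<Longrightarrow> y < b \<Longrightarrow> y \<notin> S \<Longrightarrow> \<exists>d>0. (\<theta> has_real_derivative d) (at y)"
  shows "\<theta> a < \<theta> b"
  using assms
proof (induction S arbitrary: a b rule: finite_induct)
  case empty
  then show ?case by (intro DERIV_pos_imp_increasing_open[of a b \<theta>]) auto
next
  case (insert c S)
  show ?case
  proof (cases "a < c \<and> c < b")
    case True
    have "\<theta> a < \<theta> c" "\<theta> c < \<theta> b"
      using True insert.prems
      by (auto intro!: insert.IH intro: continuous_on_subset)
    then show ?thesis by simp
  next
    case False
    then show ?thesis using insert.prems by (intro insert.IH) auto
  qed
qed

text \<open>
  Close to \<open>y\<close> the angle is \<open>\<theta> y\<close> plus the angle between \<open>v y\<close> and \<open>v z\<close>, whose tangent is the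
  quotient of their \<^const>\<open>cross\<close> and inner product.
\<close>
lemma arg_lift_DERIV:
  assumes lift: "arg_lift a b v \<theta>" and y: "a < y" "y < b"
    and p: "((\<lambda>y. Re (v y)) has_real_derivative p) (at y)"
    and q: "((\<lambda>y. Im (v y)) has_real_derivative q) (at y)"
  shows "(\<theta> has_real_derivative cross (v y) (Complex p q) / (cmod (v y))\<^sup>2) (at y)"
proof -
  let ?N = "\<lambda>z. Re (v y) * Im (v z) - Im (v y) * Re (v z)"
  let ?D = "\<lambda>z. Re (v y) * Re (v z) + Im (v y) * Im (v z)"
  obtain r where r: "r > 0" "Re (v y) = r * cos (\<theta> y)" "Im (v y) = r * sin (\<theta> y)"
    using lift y by (auto elim: arg_liftE[of a b v \<theta> y])
  have Dy: "?D y = (cmod (v y))\<^sup>2" by (simp add: cmod_power2 flip: power2_eq_square)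
  have "(cmod (v y))\<^sup>2 = r\<^sup>2 * ((cos (\<theta> y))\<^sup>2 + (sin (\<theta> y))\<^sup>2)"
    by (simp only: cmod_power2 r(2,3) power_mult_distrib algebra_simps)
  then have n0: "(cmod (v y))\<^sup>2 > 0" using r by simp
  let ?W = "cross (v y) (Complex p q)" and ?e = "Re (v y) * p + Im (v y) * q"
  have N: "(?N has_real_derivative ?W) (at y)"
    unfolding cross_def complex.sel by (intro DERIV_diff DERIV_cmult p q)
  have D: "(?D has_real_derivative ?e) (at y)"
    by (intro DERIV_add DERIV_cmult p q)
  have "((\<lambda>z. ?N z / ?D z) has_real_derivative (?W * ?D y - ?N y * ?e) / (?D y * ?D y)) (at y)"
    using n0 by (intro DERIV_divide N D) (simp add: Dy)
  moreover have "?N y = 0" by (simp add: mult.commute)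
  ultimately have "((\<lambda>z. ?N z / ?D z) has_real_derivative ?W / (cmod (v y))\<^sup>2) (at y)"
    using nonzero_mult_divide_mult_cancel_right[of "?D y" ?W "?D y"] n0 Dy
    by (simp only: mult_zero_left diff_zero)
  then have "((\<lambda>z. arctan (?N z / ?D z)) has_real_derivative
      inverse (1 + (?N y / ?D y)\<^sup>2) * (?W / (cmod (v y))\<^sup>2)) (at y)"
    by (intro DERIV_chain2[OF DERIV_arctan])
  then have "((\<lambda>z. arctan (?N z / ?D z)) has_real_derivative ?W / (cmod (v y))\<^sup>2) (at y)"
    using \<open>?N y = 0\<close> by simp
  then have "((\<lambda>z. \<theta> y + arctan (?N z / ?D z)) has_real_derivative
      0 + ?W / (cmod (v y))\<^sup>2) (at y)"
    by (intro DERIV_add DERIV_const)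
  then have deriv: "((\<lambda>z. \<theta> y + arctan (?N z / ?D z)) has_real_derivative
      ?W / (cmod (v y))\<^sup>2) (at y)"
    by simp
  have ev: "\<forall>\<^sub>F z in nhds y. \<theta> z = \<theta> y + arctan (?N z / ?D z)"
  proof -
    have "isCont \<theta> y"
      using lift y unfolding arg_lift_def by (intro continuous_on_interior[of "{a..b}"]) auto
    then have "(\<theta> \<longlongrightarrow> \<theta> y) (nhds y)" by (simp add: isCont_def tendsto_at_iff_tendsto_nhds)
    then have "\<forall>\<^sub>F z in nhds y. dist (\<theta> z) (\<theta> y) < pi / 2"
      by (rule tendstoD) simp
    moreover have "\<forall>\<^sub>F z in nhds y. z \<in> {a<..<b}"
      using y by (intro eventually_nhds_in_open) auto
    ultimately show ?thesis
    proof eventually_elim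
      case (elim z)
      obtain s where s: "s > 0" "Re (v z) = s * cos (\<theta> z)" "Im (v z) = s * sin (\<theta> z)"
        using lift elim(2) by (auto elim: arg_liftE[of a b v \<theta> z])
      have "?N z = r * s * sin (\<theta> z - \<theta> y)" "?D z = r * s * cos (\<theta> z - \<theta> y)"
        by (simp_all add: r s sin_diff cos_diff algebra_simps)
      then have "?N z / ?D z = tan (\<theta> z - \<theta> y)"
        using r(1) s(1) by (simp add: tan_def)
      moreover have "arctan (tan (\<theta> z - \<theta> y)) = \<theta> z - \<theta> y"
        using elim(1) unfolding dist_real_def by (intro arctan_tan; linarith)
      ultimately show ?case by simp
    qed
  qed
  show ?thesis using deriv DERIV_cong_ev[OF refl ev refl] by blast
qed

text \<open>
  A strictly increasing continuous function takes each multiple of \<open>\<pi>\<close> in \<open>[g a, g b)\<close> exactly once,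
  and no other one.
\<close>
lemma card_multiples_pi_crossed:
  fixes g :: "real \<Rightarrow> real"
  assumes "a \<le> b" "continuous_on {a..b} g" "strict_mono_on {a..b} g"
  defines "Z \<equiv> {y \<in> {a..<b}. sin (g y) = 0}"
  shows "finite Z" "\<bar>pi * real (card Z) - (g b - g a)\<bar> \<le> pi"
proof -
  \<comment> \<open>the integers \<open>j\<close> with \<open>g a \<le> j \<pi> < g b\<close>\<close>
  define J where "J = {\<lceil>g a / pi\<rceil>..<\<lceil>g b / pi\<rceil>}"
  have mem: "j \<in> J \<longleftrightarrow> g a \<le> of_int j * pi \<and> of_int j * pi < g b" for j
    unfolding J_def
    by (auto simp: ceiling_le_iff less_ceiling_iff pos_divide_le_eq pos_less_divide_eq)
  have mono: "g a \<le> g b"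
    using assms(1) strict_mono_on_imp_mono_on[OF assms(3)] by (auto simp: mono_on_def)
  have inj: "inj_on g Z"
    using strict_mono_on_imp_inj_on[OF assms(3)] by (rule inj_on_subset) (auto simp: Z_def)
  have im: "g ` Z = (\<lambda>j. of_int j * pi) ` J"
  proof
    show "g ` Z \<subseteq> (\<lambda>j. of_int j * pi) ` J"
    proof
      fix u assume "u \<in> g ` Z"
      then obtain y where y: "a \<le> y" "y < b" "sin (g y) = 0" "u = g y" by (auto simp: Z_def)
      then obtain j where j: "g y = of_int j * pi" using sin_zero_iff_int2 by blast
      have "g a \<le> g y" "g y < g b"
        using y strict_mono_onD[OF assms(3), of y b]
          mono_onD[OF strict_mono_on_imp_mono_on[OF assms(3)], of a y] by auto
      then show "u \<in> (\<lambda>j. of_int j * pi) ` J" using mem j y by auto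
    qed
    show "(\<lambda>j. of_int j * pi) ` J \<subseteq> g ` Z"
    proof
      fix u assume "u \<in> (\<lambda>j. of_int j * pi) ` J"
      then obtain j where j: "u = of_int j * pi" "g a \<le> u" "u < g b" using mem by auto
      then obtain y where y: "a \<le> y" "y \<le> b" "g y = u"
        using IVT'[of g a u b] assms(1,2) by auto
      moreover have "y \<noteq> b" using y j by auto
      moreover have "sin u = 0" using j sin_zero_iff_int2 by blast
      ultimately show "u \<in> g ` Z" by (auto simp: Z_def intro!: image_eqI[of _ _ y])
    qed
  qed
  have "finite (g ` Z)" unfolding im by (simp add: J_def)
  then show "finite Z" using inj finite_imageD by blast
  have "card Z = card (g ` Z)" using inj by (simp add: card_image)
  also have "\<dots> = card J"
    unfolding im by (intro card_image) (auto simp: inj_on_def)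
  also have "real (card J) = of_int \<lceil>g b / pi\<rceil> - of_int \<lceil>g a / pi\<rceil>"
    using mono by (simp add: J_def ceiling_mono divide_right_mono)
  finally have c: "real (card Z) = of_int \<lceil>g b / pi\<rceil> - of_int \<lceil>g a / pi\<rceil>" .
  have "\<bar>real (card Z) - (g b / pi - g a / pi)\<bar> \<le> 1"
    unfolding c by linarith
  then have "\<bar>pi * (real (card Z) - (g b / pi - g a / pi))\<bar> \<le> pi"
    by (simp add: abs_mult)
  then show "\<bar>pi * real (card Z) - (g b - g a)\<bar> \<le> pi"
    by (simp add: right_diff_distrib)
qed

section \<open>Monotonicity in the spectral parameter\<close>

text \<open>
  The form is the integral of \<open>(a cosh (\<kappa>\<tau>) + b sinh (\<kappa>\<tau>) / \<kappa>)\<^sup>2\<close> over \<open>\<tau> \<in> [0, 1]\<close>, where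
  \<open>\<kappa>\<^sup>2 = x\<close>, so it measures the displacement within the layer. The proof uses its
  discriminant instead, which reduces to the sign of \<open>(s\<^sup>2 - 1) / x\<close> by the determinant identity.
\<close>
lemma layer_quadratic_form_pos:
  fixes a b :: real
  assumes "x \<noteq> 0" "a \<noteq> 0 \<or> b \<noteq> 0"
  defines "s \<equiv> sinhc_root x" and "c \<equiv> cosh_root x"
  shows "(1 + s * c) / 2 * a\<^sup>2 + s\<^sup>2 * a * b + (s * c - 1) / (2 * x) * b\<^sup>2 > 0"
proof -
  define \<alpha> where "\<alpha> = (1 + s * c) / 2"
  define \<gamma> where "\<gamma> = (s * c - 1) / (2 * x)"
  define F where "F = \<alpha> * a\<^sup>2 + s\<^sup>2 * a * b + \<gamma> * b\<^sup>2"
  have \<alpha>: "\<alpha> > 0"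
    using assms(1) sinhc_cosh_root_gt_1[of x] sinhc_cosh_root_abs_lt_1[of x]
    by (cases "x > 0") (auto simp: \<alpha>_def s_def c_def)
  have det: "c\<^sup>2 - x * s\<^sup>2 = 1" unfolding c_def s_def by (rule cosh_sinhc_root_det)
  have "(s\<^sup>2 - 1) / x > 0"
  proof (cases "x > 0")
    case True
    then have "s > 1" unfolding s_def by (rule sinhc_root_gt_1)
    then have "s\<^sup>2 > 1" by simp
    with True show ?thesis by simp
  next
    case False
    with assms(1) show ?thesis
      using sinhc_root_square_lt_1[of x] by (simp add: s_def divide_neg_neg)
  qed
  moreover have "\<alpha> * \<gamma> - (s\<^sup>2 / 2)\<^sup>2 = (s\<^sup>2 * (c\<^sup>2 - x * s\<^sup>2) - 1) / (4 * x)"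
    using assms(1) by (simp add: \<alpha>_def \<gamma>_def field_simps power2_eq_square)
  moreover have "(s\<^sup>2 * 1 - 1) / (4 * x) = (s\<^sup>2 - 1) / x / 4" by simp
  ultimately have disc: "\<alpha> * \<gamma> - (s\<^sup>2 / 2)\<^sup>2 > 0"
    unfolding det by (metis divide_pos_pos zero_less_numeral)
  have sq: "\<alpha> * F = (\<alpha> * a + s\<^sup>2 / 2 * b)\<^sup>2 + (\<alpha> * \<gamma> - (s\<^sup>2 / 2)\<^sup>2) * b\<^sup>2"
    by (simp add: F_def field_simps power2_eq_square)
  have "\<alpha> * F > 0"
  proof (cases "b = 0")
    case True
    with assms(2) \<alpha> show ?thesis unfolding sq by simp
  next
    case False
    with disc show ?thesis unfolding sq by (intro add_nonneg_pos mult_pos_pos) auto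
  qed
  with \<alpha> have "F > 0" by (simp add: zero_less_mult_iff)
  then show ?thesis by (simp add: F_def \<alpha>_def \<gamma>_def)
qed

text \<open>
  The derivative of the output is the layer applied to \<open>v'\<close>, plus \<open>d\<close> times the derivative \<open>D\<close> of the
  layer in \<open>x\<close> applied to \<open>v\<close>. The first part passes on the incoming \<^const>\<open>cross\<close> unchanged, the
  second adds \<open>d / t\<close> times the positive form of \<open>layer_quadratic_form_pos\<close>.
\<close>
lemma layer_map_DERIV_cross:
  assumes "t > 0" "x y \<noteq> 0" "v y \<noteq> 0" "d > 0"
    and x: "(x has_real_derivative d) (at y)"
    and p: "((\<lambda>y. Re (v y)) has_real_derivative p) (at y)"
    and q: "((\<lambda>y. Im (v y)) has_real_derivative q) (at y)"
  obtains p' q' where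
    "((\<lambda>y. Re (layer_map t (x y) (v y))) has_real_derivative p') (at y)"
    "((\<lambda>y. Im (layer_map t (x y) (v y))) has_real_derivative q') (at y)"
    "cross (layer_map t (x y) (v y)) (Complex p' q') > cross (v y) (Complex p q)"
proof -
  let ?s = "sinhc_root (x y)" and ?c = "cosh_root (x y)"
  let ?a = "Re (v y)" and ?b = "Im (v y)"
  define D where "D = Complex (?s / 2 * ?a + t * ((?c - ?s) / (2 * x y)) * ?b)
                              ((?s + ?c) / (2 * t) * ?a + ?s / 2 * ?b)"
  define V where "V = layer_map t (x y) (Complex p q)"
  have dc: "((\<lambda>y. cosh_root (x y)) has_real_derivative ?s / 2 * d) (at y)"
    using DERIV_chain2[OF DERIV_cosh_root x] assms(2) by blast
  have ds: "((\<lambda>y. sinhc_root (x y)) has_real_derivative (?c - ?s) / (2 * x y) * d) (at y)"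
    using DERIV_chain2[OF DERIV_sinhc_root x] assms(2) by blast
  have 1: "((\<lambda>y. Re (layer_map t (x y) (v y))) has_real_derivative Re V + d * Re D) (at y)"
    unfolding layer_map_def complex.sel
    by (rule derivative_eq_intros dc ds p q refl
        | simp add: V_def D_def layer_map_def algebra_simps)+
  have 2: "((\<lambda>y. Im (layer_map t (x y) (v y))) has_real_derivative Im V + d * Im D) (at y)"
    unfolding layer_map_def complex.sel
    by (rule derivative_eq_intros dc ds x p q refl
        | use assms(1,2) in \<open>simp add: V_def D_def layer_map_def field_simps\<close>)+
  have det: "?c\<^sup>2 - x y * ?s\<^sup>2 = 1" by (rule cosh_sinhc_root_det)
  have "cross (layer_map t (x y) (v y)) D
      = 1 / t * ((?c\<^sup>2 - x y * ?s\<^sup>2 + ?s * ?c) / 2 * ?a\<^sup>2 + ?s\<^sup>2 * ?a * (t * ?b)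
          + (?s * ?c - (?c\<^sup>2 - x y * ?s\<^sup>2)) / (2 * x y) * (t * ?b)\<^sup>2)"
    using assms(1,2) by (simp add: cross_def D_def layer_map_def field_simps power2_eq_square)
  also have "\<dots> > 0"
    unfolding det using assms(1-3) layer_quadratic_form_pos[of "x y" ?a "t * ?b"]
    by (auto simp: complex_eq_iff)
  finally have pos: "cross (layer_map t (x y) (v y)) D > 0" .
  have "cross (layer_map t (x y) (v y)) (Complex (Re V + d * Re D) (Im V + d * Im D))
      = cross (layer_map t (x y) (v y)) V + d * cross (layer_map t (x y) (v y)) D"
    by (simp add: cross_def algebra_simps)
  also have "\<dots> = cross (v y) (Complex p q) + d * cross (layer_map t (x y) (v y)) D"
    using assms(1) by (simp add: V_def cross_layer_map)
  finally have "cross (layer_map t (x y) (v y)) (Complex (Re V + d * Re D) (Im V + d * Im D))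
      > cross (v y) (Complex p q)"
    using pos assms(4) by simp
  with 1 2 show ?thesis by (rule that)
qed

section \<open>Stacks of layers\<close>

primrec stack_state :: "(nat \<Rightarrow> real) \<Rightarrow> (nat \<Rightarrow> real \<Rightarrow> real) \<Rightarrow> nat \<Rightarrow> real \<Rightarrow> complex" where
  "stack_state t x 0 y = 1"
| "stack_state t x (Suc m) y = layer_map (t (Suc m)) (x (Suc m) y) (stack_state t x m y)"

lemma stack_state_nonzero:
  "(\<And>j. 1 \<le> j \<Longrightarrow> j \<le> m \<Longrightarrow> t j > 0) \<Longrightarrow> stack_state t x m y \<noteq> 0"
proof (induction m)
  case (Suc m)
  then have "t (Suc m) \<noteq> 0" "stack_state t x m y \<noteq> 0" by (force, simp)
  then show ?case by (simp add: layer_map_nonzero)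
qed simp

lemma isCont_stack_state:
  "(\<And>j. 1 \<le> j \<Longrightarrow> j \<le> m \<Longrightarrow> t j > 0 \<and> isCont (x j) y) \<Longrightarrow> isCont (stack_state t x m) y"
proof (induction m)
  case 0
  then show ?case by (simp add: fun_eq_iff[THEN iffD2, of "stack_state t x 0" "\<lambda>_. 1"])
next
  case (Suc m)
  have "stack_state t x (Suc m) = (\<lambda>y. layer_map (t (Suc m)) (x (Suc m) y) (stack_state t x m y))"
    by (simp add: fun_eq_iff)
  moreover have "t (Suc m) \<noteq> 0" using Suc.prems[of "Suc m"] by simp
  ultimately show ?case using Suc by (simp add: continuous_layer_map)
qed

text \<open>
  Each layer contributes its own phase, \<open>\<surd>(-x\<^sub>j)\<close> or zero, up to \<open>4\<pi>\<close>: one \<open>2\<pi>\<close> for replacing the incoming state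
  by \<open>1\<close>, one for replacing the angle of the image of \<open>1\<close> by the phase. The first summand on the right
  bounds the variation of an angle of the constant initial state. The constants are crude; all that matters
  is that they do not involve \<open>x\<close>, hence not the frequency.
\<close>
lemma stack_rotation_bound:
  assumes "a \<le> b" "\<And>j. 1 \<le> j \<Longrightarrow> j \<le> m \<Longrightarrow> t j > 0 \<and> (\<forall>y. isCont (x j) y)"
    and "arg_lift a b (stack_state t x m) \<theta>"
  shows "\<bar>(\<theta> b - \<theta> a) + (\<Sum>j=1..m. sqrt (max 0 (- x j b)) - sqrt (max 0 (- x j a)))\<bar>
           \<le> 2 * pi + 4 * pi * real m"
  using assms(2,3)
proof (induction m arbitrary: \<theta>)
  case 0
  have "\<bar>\<theta> b - \<theta> a\<bar> < 2 * pi"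
  proof (rule variation_lt_2pi[OF assms(1)])
    show "continuous_on {a..b} \<theta>" using 0 by (simp add: arg_lift_def)
    fix y assume "y \<in> {a..b}"
    with 0 obtain r where "r > 0" "1 = r * cos (\<theta> y)"
      by (elim arg_liftE[of a b "stack_state t x 0" \<theta> y]) auto
    then show "cos (\<theta> y) \<noteq> -1" by auto
  qed
  then show ?case by simp
next
  case (Suc m)
  let ?t = "t (Suc m)" and ?x = "x (Suc m)" and ?v = "stack_state t x m"
  have t: "?t > 0" and x: "\<And>y. isCont ?x y" using Suc.prems(1)[of "Suc m"] by auto
  have v: "isCont ?v y" "?v y \<noteq> 0" for y
    using Suc.prems(1) by (auto intro!: isCont_stack_state stack_state_nonzero)
  have "continuous_on {a..b} ?v" using v by (intro continuous_at_imp_continuous_on) simp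
  then obtain \<psi> where \<psi>: "arg_lift a b ?v \<psi>"
    using v(2) arg_lift_exists by blast
  have "continuous_on {a..b} (\<lambda>y. layer_map ?t (?x y) 1)"
    using t x continuous_layer_map[where v = "\<lambda>_. 1" and x = ?x and t = ?t]
    by (intro continuous_at_imp_continuous_on) simp
  moreover have "layer_map ?t (?x y) 1 \<noteq> 0" for y
    using t layer_map_nonzero[of ?t 1 "?x y"] by simp
  ultimately obtain \<phi> where \<phi>: "arg_lift a b (\<lambda>y. layer_map ?t (?x y) 1) \<phi>"
    using arg_lift_exists by blast
  have \<theta>: "arg_lift a b (\<lambda>y. layer_map ?t (?x y) (?v y)) \<theta>"
    using Suc.prems(2) by (simp add: arg_lift_def)
  have "\<bar>(\<theta> b - \<theta> a) - (\<phi> b - \<phi> a) - (\<psi> b - \<psi> a)\<bar> < 2 * pi"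
    by (rule arg_lift_layer_variation[OF assms(1) t \<psi> \<phi> \<theta>])
  moreover have "\<bar>(\<phi> b - \<phi> a) + (sqrt (max 0 (- ?x b)) - sqrt (max 0 (- ?x a)))\<bar> < 2 * pi"
    using x by (intro arg_lift_reference_variation[OF assms(1) t _ \<phi>])
      (auto intro: continuous_at_imp_continuous_on)
  moreover have "\<bar>(\<psi> b - \<psi> a) + (\<Sum>j=1..m. sqrt (max 0 (- x j b)) - sqrt (max 0 (- x j a)))\<bar>
           \<le> 2 * pi + 4 * pi * real m"
    using Suc.IH[OF _ \<psi>] Suc.prems(1) by simp
  ultimately show ?case by (simp add: algebra_simps)
qed

lemma stack_state_DERIV_cross:
  assumes "m \<ge> 1"
    and "\<And>j. 1 \<le> j \<Longrightarrow> j \<le> m \<Longrightarrow> t j > 0 \<and> x j y \<noteq> 0 \<and> (\<exists>d>0. (x j has_real_derivative d) (at y))"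
  obtains p q where
    "((\<lambda>y. Re (stack_state t x m y)) has_real_derivative p) (at y)"
    "((\<lambda>y. Im (stack_state t x m y)) has_real_derivative q) (at y)"
    "cross (stack_state t x m y) (Complex p q) > 0"
proof -
  have "\<exists>p q. ((\<lambda>y. Re (stack_state t x m y)) has_real_derivative p) (at y) \<and>
      ((\<lambda>y. Im (stack_state t x m y)) has_real_derivative q) (at y) \<and>
      cross (stack_state t x m y) (Complex p q) \<ge> 0 \<and>
      (m \<ge> 1 \<longrightarrow> cross (stack_state t x m y) (Complex p q) > 0)"
    using assms(2)
  proof (induction m)
    case 0
    show ?case by (intro exI[of _ 0]) (simp add: cross_def)
  next
    case (Suc m)
    then obtain p q where pq: "((\<lambda>y. Re (stack_state t x m y)) has_real_derivative p) (at y)"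
      "((\<lambda>y. Im (stack_state t x m y)) has_real_derivative q) (at y)"
      "cross (stack_state t x m y) (Complex p q) \<ge> 0"
      by (metis le_SucI)
    obtain d where d: "t (Suc m) > 0" "x (Suc m) y \<noteq> 0" "d > 0"
      "(x (Suc m) has_real_derivative d) (at y)"
      using Suc.prems[of "Suc m"] by auto
    have nz: "stack_state t x m y \<noteq> 0" using Suc.prems by (intro stack_state_nonzero) auto
    let ?L = "\<lambda>y. layer_map (t (Suc m)) (x (Suc m) y) (stack_state t x m y)"
    obtain p' q' where
      "((\<lambda>y. Re (?L y)) has_real_derivative p') (at y)"
      "((\<lambda>y. Im (?L y)) has_real_derivative q') (at y)"
      "cross (?L y) (Complex p' q') > cross (stack_state t x m y) (Complex p q)"
      by (rule layer_map_DERIV_cross[OF d(1,2) nz d(3,4) pq(1,2)])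
    then show ?case using pq(3) by (intro exI[of _ p'] exI[of _ q']) simp
  qed
  then show ?thesis using assms(1) that by blast
qed

section \<open>The dispersion function in terms of the angle\<close>

lemma cosh_complex_of_real: "cosh (complex_of_real r) = of_real (cosh r)"
  by (simp add: cosh_field_def exp_of_real flip: of_real_minus)

lemma sinh_complex_of_real: "sinh (complex_of_real r) = of_real (sinh r)"
  by (simp add: sinh_field_def exp_of_real flip: of_real_minus)

text \<open>
  The value of \<open>(\<nu>\<^sub>j T\<^sub>j)\<^sup>2\<close> at \<open>k = \<omega> y\<close>.
\<close>
definition layer_argument ::
    "(nat \<Rightarrow> ereal) \<Rightarrow> (nat \<Rightarrow> real) \<Rightarrow> (nat \<Rightarrow> real) \<Rightarrow> real \<Rightarrow> nat \<Rightarrow> real \<Rightarrow> real" where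
  "layer_argument H \<mu> \<rho> \<omega> j y =
     (\<omega> * real_of_ereal (thickness H j))\<^sup>2 * (y\<^sup>2 - 1 / (wave_speed \<mu> \<rho> j)\<^sup>2)"

definition layer_compliance :: "(nat \<Rightarrow> ereal) \<Rightarrow> (nat \<Rightarrow> real) \<Rightarrow> nat \<Rightarrow> real" where
  "layer_compliance H \<mu> j = real_of_ereal (thickness H j) / \<mu> j"

lemma transfer_matrix_layer_map:
  assumes "\<omega> > 0" "\<mu> j > 0" "real_of_ereal (thickness H j) > 0"
  shows "transfer_matrix H \<mu> \<rho> j \<omega> (\<omega> * y) *v vector [of_real (Re v), of_real (Im v)]
    = vector [of_real (Re (layer_map (layer_compliance H \<mu> j) (layer_argument H \<mu> \<rho> \<omega> j y) v)),
              of_real (Im (layer_map (layer_compliance H \<mu> j) (layer_argument H \<mu> \<rho> \<omega> j y) v))]"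
proof -
  define T where "T = real_of_ereal (thickness H j)"
  define w where "w = y\<^sup>2 - 1 / (wave_speed \<mu> \<rho> j)\<^sup>2"
  have T: "T > 0" using assms by (simp add: T_def)
  have x: "layer_argument H \<mu> \<rho> \<omega> j y = (\<omega> * T)\<^sup>2 * w"
    by (simp add: layer_argument_def T_def w_def)
  have t: "layer_compliance H \<mu> j = T / \<mu> j" by (simp add: layer_compliance_def T_def)
  have nu: "nu \<mu> \<rho> j \<omega> (\<omega> * y) = of_real \<omega> * branch_sqrt w"
    using assms(1) by (simp add: nu_def w_def power_mult_distrib)
  have tm: "transfer_matrix H \<mu> \<rho> j \<omega> (\<omega> * y) =
     vector [vector [of_real (cosh_root ((\<omega> * T)\<^sup>2 * w)),
                     of_real (T / \<mu> j * sinhc_root ((\<omega> * T)\<^sup>2 * w))],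
             vector [of_real ((\<omega> * T)\<^sup>2 * w * sinhc_root ((\<omega> * T)\<^sup>2 * w) / (T / \<mu> j)),
                     of_real (cosh_root ((\<omega> * T)\<^sup>2 * w))]]"
  proof -
    consider "w = 0" | "w > 0" | "w < 0" by linarith
    then show ?thesis
    proof cases
      case 1
      then show ?thesis
        by (simp add: transfer_matrix_def Let_def nu branch_sqrt_def cosh_root_def sinhc_root_def T_def)
    next
      case 2
      define k where "k = \<omega> * sqrt w"
      have k: "k > 0" using 2 assms(1) by (simp add: k_def)
      have nuk: "nu \<mu> \<rho> j \<omega> (\<omega> * y) = of_real k"
        using 2 by (simp add: nu branch_sqrt_def k_def)
      have xk: "(\<omega> * T)\<^sup>2 * w = (k * T)\<^sup>2"
        using 2 by (simp add: k_def power_mult_distrib)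
      have c: "cosh_root ((k * T)\<^sup>2) = cosh (k * T)"
        using k T by (simp add: cosh_root_def)
      have s: "sinhc_root ((k * T)\<^sup>2) = sinh (k * T) / (k * T)"
        using k T by (simp add: sinhc_root_def)
      have "k * T > 0" using k T by simp
      then show ?thesis
        unfolding transfer_matrix_def Let_def nuk xk c s T_def[symmetric]
        using k T assms(2)
        by (simp add: cosh_complex_of_real sinh_complex_of_real field_simps power2_eq_square
            flip: of_real_mult)
    next
      case 3
      define k where "k = \<omega> * sqrt (- w)"
      have k: "k > 0" using 3 assms(1) by (simp add: k_def)
      have nuk: "nu \<mu> \<rho> j \<omega> (\<omega> * y) = - \<i> * of_real k"
        using 3 by (simp add: nu branch_sqrt_def k_def)
      have xk: "(\<omega> * T)\<^sup>2 * w = - ((k * T)\<^sup>2)"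
        using 3 by (simp add: k_def power_mult_distrib)
      have c: "cosh_root (- ((k * T)\<^sup>2)) = cos (k * T)"
        using k T by (simp add: cosh_root_def)
      have s: "sinhc_root (- ((k * T)\<^sup>2)) = sin (k * T) / (k * T)"
        using k T by (simp add: sinhc_root_def)
      have rot: "\<i> * (- \<i> * of_real k * of_real T) = complex_of_real (k * T)"
        by (simp add: complex_eq_iff)
      have ch: "cosh (- \<i> * of_real k * of_real T) = complex_of_real (cos (k * T))"
        unfolding cosh_conv_cos rot by (rule cos_of_real)
      have sh: "sinh (- \<i> * of_real k * of_real T) = - \<i> * complex_of_real (sin (k * T))"
        unfolding sinh_conv_sin rot by (simp only: sin_of_real)
      have "k * T > 0" using k T by simp
      then show ?thesis
        unfolding transfer_matrix_def Let_def nuk xk c s T_def[symmetric] ch sh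
        using k T assms(2)
        by (simp add: field_simps power2_eq_square)
    qed
  qed
  show ?thesis
    unfolding tm x t layer_map_def complex.sel
    by (simp add: vec_eq_iff forall_2 matrix_vector_mult_def sum_2)
qed

definition medium_state ::
    "(nat \<Rightarrow> ereal) \<Rightarrow> (nat \<Rightarrow> real) \<Rightarrow> (nat \<Rightarrow> real) \<Rightarrow> real \<Rightarrow> nat \<Rightarrow> real \<Rightarrow> complex" where
  "medium_state H \<mu> \<rho> \<omega> = stack_state (layer_compliance H \<mu>) (layer_argument H \<mu> \<rho> \<omega>)"

lemma PQ_eq_medium_state:
  assumes "\<omega> > 0" "\<And>j. 1 \<le> j \<Longrightarrow> j \<le> m \<Longrightarrow> \<mu> j > 0 \<and> real_of_ereal (thickness H j) > 0"
  shows "PQ H \<mu> \<rho> \<omega> (\<omega> * y) m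
    = vector [of_real (Re (medium_state H \<mu> \<rho> \<omega> m y)), of_real (Im (medium_state H \<mu> \<rho> \<omega> m y))]"
  using assms(2)
proof (induction m)
  case 0
  then show ?case by (simp add: medium_state_def)
next
  case (Suc m)
  then have "PQ H \<mu> \<rho> \<omega> (\<omega> * y) m
    = vector [of_real (Re (medium_state H \<mu> \<rho> \<omega> m y)), of_real (Im (medium_state H \<mu> \<rho> \<omega> m y))]"
    by simp
  then show ?case
    using Suc.prems[of "Suc m"] assms(1)
    by (simp add: transfer_matrix_layer_map medium_state_def)
qed

lemma layer_thickness_pos:
  assumes "layered_medium n H \<mu> \<rho>" "1 \<le> j" "j \<le> n"
  shows "real_of_ereal (thickness H j) > 0"
proof -
  have step: "H i < H (i + 1)" if "i \<in> {1..n+1}" for i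
    using assms(1) that by (simp add: layered_medium_def)
  have nonneg: "1 \<le> i \<Longrightarrow> i \<le> n + 1 \<Longrightarrow> 0 \<le> H i" for i
  proof (induction i rule: dec_induct)
    case base
    show ?case using assms(1) by (simp add: layered_medium_def)
  next
    case (step i)
    then show ?case using \<open>\<And>i. i \<in> {1..n+1} \<Longrightarrow> H i < H (i + 1)\<close>[of i] by force
  qed
  have "0 \<le> H j" "H j < H (j + 1)" "H (j + 1) < H (j + 2)"
    using nonneg[of j] step[of j] step[of "j + 1"] assms(2,3) by (auto simp: add.commute)
  then show ?thesis
    unfolding thickness_def by (cases "H j"; cases "H (j + 1)"; cases "H (j + 2)") auto
qed

section \<open>Counting branches\<close>

lemma counting_eq_card:
  assumes "finite (wavenumbers n H \<mu> \<rho> \<omega>)" "\<omega> > 0"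
  shows "counting n H \<mu> \<rho> \<omega> y = card {k \<in> wavenumbers n H \<mu> \<rho> \<omega>. \<omega> * y \<le> k}"
proof -
  let ?W = "wavenumbers n H \<mu> \<rho> \<omega>"
  define xs where "xs = rev (sorted_list_of_set ?W)"
  have xs: "length xs = card ?W" "set xs = ?W" "distinct xs"
    using assms(1) by (simp_all add: xs_def)
  have "{l. 1 \<le> l \<and> ereal y \<le> branch n H \<mu> \<rho> l \<omega> / ereal \<omega>}
      = Suc ` {i. i < length xs \<and> \<omega> * y \<le> xs ! i}"
  proof (intro set_eqI iffI)
    fix l assume "l \<in> {l. 1 \<le> l \<and> ereal y \<le> branch n H \<mu> \<rho> l \<omega> / ereal \<omega>}"
    then have l: "1 \<le> l" "ereal y \<le> branch n H \<mu> \<rho> l \<omega> / ereal \<omega>" by auto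
    then have "l \<le> card ?W"
      using assms(2) by (auto simp: branch_def split: if_splits)
    then have "\<omega> * y \<le> xs ! (l - 1)"
      using l assms(2) by (simp add: branch_def xs_def field_simps)
    with l \<open>l \<le> card ?W\<close> xs show "l \<in> Suc ` {i. i < length xs \<and> \<omega> * y \<le> xs ! i}"
      by (intro image_eqI[of _ _ "l - 1"]) auto
  next
    fix l assume "l \<in> Suc ` {i. i < length xs \<and> \<omega> * y \<le> xs ! i}"
    then obtain i where "l = Suc i" "i < card ?W" "\<omega> * y \<le> xs ! i" using xs by auto
    then show "l \<in> {l. 1 \<le> l \<and> ereal y \<le> branch n H \<mu> \<rho> l \<omega> / ereal \<omega>}"
      using assms(2) by (simp add: branch_def xs_def field_simps)
  qed
  then have "counting n H \<mu> \<rho> \<omega> y = card {i. i < length xs \<and> \<omega> * y \<le> xs ! i}"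
    by (simp add: counting_def card_image)
  also have "\<dots> = length (filter (\<lambda>k. \<omega> * y \<le> k) xs)"
    by (simp add: length_filter_conv_card)
  also have "\<dots> = card (set (filter (\<lambda>k. \<omega> * y \<le> k) xs))"
    using xs by (intro distinct_card[symmetric]) simp
  also have "set (filter (\<lambda>k. \<omega> * y \<le> k) xs) = {k \<in> ?W. \<omega> * y \<le> k}"
    using xs by auto
  finally show ?thesis .
qed

lemma asymp_equiv_linear:
  fixes f :: "real \<Rightarrow> real"
  assumes "S > 0" "\<And>\<omega>. \<omega> > 0 \<Longrightarrow> \<bar>pi * f \<omega> - \<omega> * S\<bar> \<le> K"
  shows "f \<sim>[at_top] (\<lambda>\<omega>. \<omega> / pi * S)"
proof (rule asymp_equivI')
  have "((\<lambda>\<omega>. f \<omega> / (\<omega> / pi * S) - 1) \<longlongrightarrow> 0) at_top"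
  proof (rule Lim_null_comparison)
    show "\<forall>\<^sub>F \<omega> in at_top. norm (f \<omega> / (\<omega> / pi * S) - 1) \<le> (K / S) / \<omega>"
      using eventually_gt_at_top[of "0 :: real"]
    proof eventually_elim
      case (elim \<omega>)
      then have "f \<omega> / (\<omega> / pi * S) - 1 = (pi * f \<omega> - \<omega> * S) / (\<omega> * S)"
        using assms(1) by (simp add: field_simps)
      then have "norm (f \<omega> / (\<omega> / pi * S) - 1) = \<bar>pi * f \<omega> - \<omega> * S\<bar> / (\<omega> * S)"
        using elim assms(1) by (simp add: abs_divide)
      also have "\<dots> \<le> K / (\<omega> * S)"
        using elim assms by (intro divide_right_mono) auto
      finally show ?case by (simp add: mult.commute)
    qed
    show "((\<lambda>\<omega>. (K / S) / \<omega>) \<longlongrightarrow> 0) at_top"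
      by (intro tendsto_divide_0[OF tendsto_const] filterlim_at_top_imp_at_infinity filterlim_ident)
  qed
  then show "((\<lambda>\<omega>. f \<omega> / (\<omega> / pi * S)) \<longlongrightarrow> 1) at_top"
    by (simp add: LIM_zero_iff)
qed

section \<open>The total phase of the oscillating layers\<close>

definition total_phase ::
    "nat \<Rightarrow> (nat \<Rightarrow> ereal) \<Rightarrow> (nat \<Rightarrow> real) \<Rightarrow> (nat \<Rightarrow> real) \<Rightarrow> real \<Rightarrow> real" where
  "total_phase n H \<mu> \<rho> y =
     (\<Sum>j | j \<in> {1..n} \<and> y < 1 / wave_speed \<mu> \<rho> j. layer_phase H \<mu> \<rho> j y)"

lemma wave_speed_pos:
  "layered_medium n H \<mu> \<rho> \<Longrightarrow> 1 \<le> j \<Longrightarrow> j \<le> n + 1 \<Longrightarrow> wave_speed \<mu> \<rho> j > 0"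
  by (simp add: layered_medium_def wave_speed_def)

lemma min_speed_le: "1 \<le> j \<Longrightarrow> j \<le> n + 1 \<Longrightarrow> min_speed n \<mu> \<rho> \<le> wave_speed \<mu> \<rho> j"
  by (simp add: min_speed_def)

lemma min_speed_attained: "\<exists>j\<in>{1..n+1}. min_speed n \<mu> \<rho> = wave_speed \<mu> \<rho> j"
proof -
  have "min_speed n \<mu> \<rho> \<in> wave_speed \<mu> \<rho> ` {1..n+1}"
    unfolding min_speed_def by (intro Min_in) auto
  then show ?thesis by blast
qed

lemma sqrt_layer_argument:
  assumes "\<omega> > 0" "y > 0" "wave_speed \<mu> \<rho> j > 0" "real_of_ereal (thickness H j) > 0"
  shows "sqrt (max 0 (- layer_argument H \<mu> \<rho> \<omega> j y))
    = (if y < 1 / wave_speed \<mu> \<rho> j then \<omega> * layer_phase H \<mu> \<rho> j y else 0)"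
proof -
  let ?T = "real_of_ereal (thickness H j)" and ?w = "y\<^sup>2 - (1 / wave_speed \<mu> \<rho> j)\<^sup>2"
  have x: "layer_argument H \<mu> \<rho> \<omega> j y = (\<omega> * ?T)\<^sup>2 * ?w"
    by (simp add: layer_argument_def power_one_over)
  show ?thesis
  proof (cases "y < 1 / wave_speed \<mu> \<rho> j")
    case True
    then have w: "?w < 0"
      using assms(2) by (simp add: power_strict_mono del: power_one_over)
    then have "layer_argument H \<mu> \<rho> \<omega> j y \<le> 0"
      unfolding x by (intro mult_nonneg_nonpos) auto
    then have "sqrt (max 0 (- layer_argument H \<mu> \<rho> \<omega> j y)) = sqrt (- layer_argument H \<mu> \<rho> \<omega> j y)"
      by simp
    also have "\<dots> = sqrt ((\<omega> * ?T)\<^sup>2 * (- ?w))"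
      by (simp only: x mult_minus_right)
    also have "\<dots> = \<omega> * ?T * sqrt (- ?w)"
      using assms(1,4) by (simp add: real_sqrt_mult)
    finally show ?thesis
      using True w by (simp add: layer_phase_def nu_bar_def branch_sqrt_def norm_mult power_one_over)
  next
    case False
    then have "?w \<ge> 0"
      using assms(3) by (simp add: power_mono)
    then have "layer_argument H \<mu> \<rho> \<omega> j y \<ge> 0" unfolding x by (intro mult_nonneg_nonneg) auto
    then show ?thesis using False by (simp add: max_def)
  qed
qed

text \<open>
  At the right end \<open>b \<ge> 1/C\<^sub>0\<close> all layers are evanescent, so only the phases at \<open>a\<close> remain.
\<close>
lemma medium_state_rotation:
  assumes "layered_medium n H \<mu> \<rho>" "\<omega> > 0" "0 < a" "a \<le> b" "1 / min_speed n \<mu> \<rho> \<le> b"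
    and "arg_lift a b (medium_state H \<mu> \<rho> \<omega> n) \<theta>"
  shows "\<bar>(\<theta> b - \<theta> a) - \<omega> * total_phase n H \<mu> \<rho> a\<bar> \<le> 2 * pi + 4 * pi * real n"
proof -
  let ?x = "layer_argument H \<mu> \<rho> \<omega>" and ?t = "layer_compliance H \<mu>"
  have "\<bar>(\<theta> b - \<theta> a) + (\<Sum>j=1..n. sqrt (max 0 (- ?x j b)) - sqrt (max 0 (- ?x j a)))\<bar>
          \<le> 2 * pi + 4 * pi * real n"
  proof (rule stack_rotation_bound[OF assms(4)])
    fix j assume j: "1 \<le> j" "j \<le> n"
    then have "\<mu> j > 0" using assms(1) by (simp add: layered_medium_def)
    then have "?t j > 0"
      using layer_thickness_pos[OF assms(1) j] by (simp add: layer_compliance_def)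
    moreover have "isCont (?x j) y" for y
      unfolding layer_argument_def[abs_def] by (intro continuous_intros)
    ultimately show "?t j > 0 \<and> (\<forall>y. isCont (?x j) y)" by blast
  qed (use assms(6) in \<open>simp add: medium_state_def\<close>)
  also have "(\<Sum>j=1..n. sqrt (max 0 (- ?x j b)) - sqrt (max 0 (- ?x j a)))
      = (\<Sum>j=1..n. - (if a < 1 / wave_speed \<mu> \<rho> j then \<omega> * layer_phase H \<mu> \<rho> j a else 0))"
  proof (rule sum.cong[OF refl])
    fix j assume "j \<in> {1..n}"
    then have j: "1 \<le> j" "j \<le> n" "j \<le> n + 1" by auto
    have pos: "real_of_ereal (thickness H j) > 0" "wave_speed \<mu> \<rho> j > 0"
      using layer_thickness_pos wave_speed_pos assms(1) j by blast+
    have "0 < min_speed n \<mu> \<rho>"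
      using min_speed_attained[of n \<mu> \<rho>] wave_speed_pos[OF assms(1)] by auto
    then have "1 / wave_speed \<mu> \<rho> j \<le> 1 / min_speed n \<mu> \<rho>"
      using min_speed_le[OF j(1,3)] by (intro divide_left_mono) (use pos in auto)
    then show "sqrt (max 0 (- ?x j b)) - sqrt (max 0 (- ?x j a))
        = - (if a < 1 / wave_speed \<mu> \<rho> j then \<omega> * layer_phase H \<mu> \<rho> j a else 0)"
      using assms(2-5) pos by (simp add: sqrt_layer_argument)
  qed
  also have "\<dots> = - (\<omega> * total_phase n H \<mu> \<rho> a)"
    by (simp add: total_phase_def sum_negf sum_distrib_left sum.If_cases Int_def)
  finally show ?thesis by simp
qed

text \<open>
  The slownesses \<open>1/C\<^sub>j\<close> are the parameters at which a layer passes from oscillating to evanescent; they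
  form the finite exceptional set.
\<close>
lemma medium_state_angle_increasing:
  assumes med: "layered_medium n H \<mu> \<rho>" and \<omega>: "\<omega> > 0"
    and "0 < a" and lift: "arg_lift a b (medium_state H \<mu> \<rho> \<omega> n) \<theta>"
  shows "strict_mono_on {a..b} \<theta>"
proof (rule strict_mono_onI)
  fix u v assume uv: "u \<in> {a..b}" "v \<in> {a..b}" "u < v"
  let ?x = "layer_argument H \<mu> \<rho> \<omega>" and ?t = "layer_compliance H \<mu>"
  show "\<theta> u < \<theta> v"
  proof (rule strict_increasing_off_finite
      [where \<theta> = \<theta> and S = "(\<lambda>j. 1 / wave_speed \<mu> \<rho> j) ` {1..n}"])
    show "continuous_on {u..v} \<theta>"
      using lift uv unfolding arg_lift_def by (auto intro: continuous_on_subset)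
    fix y assume y: "u < y" "y < v" "y \<notin> (\<lambda>j. 1 / wave_speed \<mu> \<rho> j) ` {1..n}"
    then have y0: "y > 0" using uv assms(3) by auto
    have layer: "?t j > 0 \<and> ?x j y \<noteq> 0 \<and> (\<exists>d>0. (?x j has_real_derivative d) (at y))"
      if j: "1 \<le> j" "j \<le> n" for j
    proof (intro conjI)
      have T: "real_of_ereal (thickness H j) > 0" using layer_thickness_pos[OF med j] .
      have "\<mu> j > 0" using med j by (simp add: layered_medium_def)
      with T show "?t j > 0" by (simp add: layer_compliance_def)
      have C: "wave_speed \<mu> \<rho> j > 0" using wave_speed_pos[OF med] j by simp
      have "y \<noteq> 1 / wave_speed \<mu> \<rho> j" using y j by auto
      then have "y\<^sup>2 \<noteq> (1 / wave_speed \<mu> \<rho> j)\<^sup>2"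
        using y0 C by (subst power2_eq_iff_nonneg) auto
      then show "?x j y \<noteq> 0"
        using T \<omega> by (simp add: layer_argument_def power_one_over)
      have "(?x j has_real_derivative (\<omega> * real_of_ereal (thickness H j))\<^sup>2 * (2 * y)) (at y)"
        unfolding layer_argument_def[abs_def] by (auto intro!: derivative_eq_intros)
      moreover have "(\<omega> * real_of_ereal (thickness H j))\<^sup>2 * (2 * y) > 0"
        using T \<omega> y0 by simp
      ultimately show "\<exists>d>0. (?x j has_real_derivative d) (at y)" by blast
    qed
    have n: "n \<ge> 1" using med by (simp add: layered_medium_def)
    obtain p q where pq:
      "((\<lambda>y. Re (medium_state H \<mu> \<rho> \<omega> n y)) has_real_derivative p) (at y)"
      "((\<lambda>y. Im (medium_state H \<mu> \<rho> \<omega> n y)) has_real_derivative q) (at y)"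
      "cross (medium_state H \<mu> \<rho> \<omega> n y) (Complex p q) > 0"
      unfolding medium_state_def by (rule stack_state_DERIV_cross[OF n layer])
    have "medium_state H \<mu> \<rho> \<omega> n y \<noteq> 0"
      unfolding medium_state_def using layer by (intro stack_state_nonzero) blast
    moreover have "a < y" "y < b" using y uv by auto
    ultimately show "\<exists>d>0. (\<theta> has_real_derivative d) (at y)"
      using arg_lift_DERIV[OF lift _ _ pq(1,2)] pq(3) by (intro exI conjI) auto
  qed (use uv in auto)
qed

text \<open>
  The angle below the horizontal axis of the state \<open>(1, - \<mu>\<^sub>n\<^sub>+\<^sub>1 \<nu>\<^sub>n\<^sub>+\<^sub>1)\<close> of the wave that decays in the
  half-space. A mode occurs when the state at the bottom of the stack is parallel to it.
\<close>
definition halfspace_angle ::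
    "nat \<Rightarrow> (nat \<Rightarrow> real) \<Rightarrow> (nat \<Rightarrow> real) \<Rightarrow> real \<Rightarrow> real \<Rightarrow> real" where
  "halfspace_angle n \<mu> \<rho> \<omega> y =
     arctan (\<mu> (n+1) * \<omega> * sqrt (y\<^sup>2 - (1 / speed_infinity n \<mu> \<rho>)\<^sup>2))"

lemma dispersion_eq_0_iff:
  assumes med: "layered_medium n H \<mu> \<rho>" and \<omega>: "\<omega> > 0"
    and y: "1 / speed_infinity n \<mu> \<rho> \<le> y"
    and r: "r > 0" "medium_state H \<mu> \<rho> \<omega> n y = rcis r \<theta>"
  shows "dispersion n H \<mu> \<rho> \<omega> (\<omega> * y) = 0 \<longleftrightarrow> sin (\<theta> + halfspace_angle n \<mu> \<rho> \<omega> y) = 0"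
proof -
  let ?w = "y\<^sup>2 - (1 / speed_infinity n \<mu> \<rho>)\<^sup>2"
  define e where "e = \<mu> (n+1) * \<omega> * sqrt ?w"
  have C: "speed_infinity n \<mu> \<rho> > 0"
    using wave_speed_pos[OF med, of "n+1"] by (simp add: speed_infinity_def)
  have "?w \<ge> 0" using y C by (simp add: power_mono)
  then have nu: "of_real (\<mu> (n+1)) * nu \<mu> \<rho> (n+1) \<omega> (\<omega> * y) = complex_of_real e"
    using \<omega> by (simp add: nu_def branch_sqrt_def e_def speed_infinity_def power_mult_distrib
        power_one_over)
  have PQ: "PQ H \<mu> \<rho> \<omega> (\<omega> * y) n
    = vector [of_real (Re (medium_state H \<mu> \<rho> \<omega> n y)), of_real (Im (medium_state H \<mu> \<rho> \<omega> n y))]"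
    using layer_thickness_pos[OF med] med
    by (intro PQ_eq_medium_state \<omega>) (auto simp: layered_medium_def)
  have "dispersion n H \<mu> \<rho> \<omega> (\<omega> * y) = of_real (e * (r * cos \<theta>) + r * sin \<theta>)"
    unfolding dispersion_def nu PQ r(2) by simp
  then have "dispersion n H \<mu> \<rho> \<omega> (\<omega> * y) = 0 \<longleftrightarrow> r * (sin \<theta> + e * cos \<theta>) = 0"
    by (simp only: of_real_eq_0_iff) (simp add: algebra_simps)
  also have "\<dots> \<longleftrightarrow> sin \<theta> + e * cos \<theta> = 0" using r(1) by simp
  \<comment> \<open>the factor \<open>cos (arctan e)\<close> turns the sum into a single sine\<close>
  also have "\<dots> \<longleftrightarrow> cos (arctan e) * (sin \<theta> + tan (arctan e) * cos \<theta>) = 0"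
    using cos_arctan_not_zero[of e] by (simp only: tan_arctan mult_eq_0_iff simp_thms)
  also have "cos (arctan e) * (sin \<theta> + tan (arctan e) * cos \<theta>) = sin (\<theta> + arctan e)"
    using cos_arctan_not_zero[of e] by (simp add: sin_add tan_def field_simps)
  finally show ?thesis by (simp add: halfspace_angle_def e_def)
qed

lemma halfspace_angle_mono:
  assumes "layered_medium n H \<mu> \<rho>" "\<omega> > 0" "0 \<le> y" "y \<le> z"
  shows "halfspace_angle n \<mu> \<rho> \<omega> y \<le> halfspace_angle n \<mu> \<rho> \<omega> z"
proof -
  have "\<mu> (n+1) > 0" using assms(1) by (simp add: layered_medium_def)
  then show ?thesis
    using assms(2-4) unfolding halfspace_angle_def
    by (intro arctan_monotone' mult_left_mono real_sqrt_le_mono diff_right_mono power_mono) auto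
qed

lemma dispersion_zeros_count:
  assumes med: "layered_medium n H \<mu> \<rho>" and \<omega>: "\<omega> > 0"
    and y: "1 / speed_infinity n \<mu> \<rho> \<le> y" "y < 1 / min_speed n \<mu> \<rho>"
  defines "Z \<equiv> {u \<in> {y..<1 / min_speed n \<mu> \<rho>}. dispersion n H \<mu> \<rho> \<omega> (\<omega> * u) = 0}"
  shows "finite Z"
    and "\<bar>pi * real (card Z) - \<omega> * total_phase n H \<mu> \<rho> y\<bar> \<le> 4 * pi + 4 * pi * real n"
proof -
  define b where "b = 1 / min_speed n \<mu> \<rho>"
  let ?v = "medium_state H \<mu> \<rho> \<omega> n" and ?h = "halfspace_angle n \<mu> \<rho> \<omega>"
  have "speed_infinity n \<mu> \<rho> > 0"
    using wave_speed_pos[OF med, of "n+1"] by (simp add: speed_infinity_def)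
  then have y0: "y > 0" using y(1) by (meson less_le_trans zero_less_divide_1_iff)
  have yb: "y \<le> b" using y(2) by (simp add: b_def)
  have t: "layer_compliance H \<mu> j > 0" if "1 \<le> j" "j \<le> n" for j
    using layer_thickness_pos[OF med that] med that
    by (simp add: layer_compliance_def layered_medium_def)
  have "isCont (layer_argument H \<mu> \<rho> \<omega> j) u" for j u
    unfolding layer_argument_def[abs_def] by (intro continuous_intros)
  then have "continuous_on {y..b} ?v"
    unfolding medium_state_def
    by (intro continuous_at_imp_continuous_on ballI isCont_stack_state) (auto simp: t)
  moreover have "?v u \<noteq> 0" for u
    unfolding medium_state_def using t by (intro stack_state_nonzero) auto
  ultimately obtain \<theta> where \<theta>: "arg_lift y b ?v \<theta>" using arg_lift_exists by blast
  define g where "g u = \<theta> u + ?h u" for u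
  have g_cont: "continuous_on {y..b} g"
    using \<theta> unfolding g_def arg_lift_def halfspace_angle_def by (intro continuous_intros) auto
  have g_mono: "strict_mono_on {y..b} g"
  proof (rule strict_mono_onI)
    fix u v assume uv: "u \<in> {y..b}" "v \<in> {y..b}" "u < v"
    then have "\<theta> u < \<theta> v"
      using strict_mono_onD[OF medium_state_angle_increasing[OF med \<omega> y0 \<theta>]] by blast
    moreover have "?h u \<le> ?h v" using uv y0 by (intro halfspace_angle_mono[OF med \<omega>]) auto
    ultimately show "g u < g v" by (simp add: g_def)
  qed
  have Z: "Z = {u \<in> {y..<b}. sin (g u) = 0}"
  proof -
    have "dispersion n H \<mu> \<rho> \<omega> (\<omega> * u) = 0 \<longleftrightarrow> sin (g u) = 0" if "u \<in> {y..<b}" for u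
    proof -
      have "u \<in> {y..b}" using that by simp
      then obtain r where "r > 0" "?v u = rcis r (\<theta> u)" using \<theta> unfolding arg_lift_def by blast
      then show ?thesis
        unfolding g_def using that y(1) by (intro dispersion_eq_0_iff[OF med \<omega>]) auto
    qed
    then show ?thesis unfolding Z_def b_def[symmetric] by blast
  qed
  show "finite Z" unfolding Z by (rule card_multiples_pi_crossed(1)[OF yb g_cont g_mono])
  have "\<bar>pi * real (card Z) - (g b - g y)\<bar> \<le> pi"
    unfolding Z by (rule card_multiples_pi_crossed(2)[OF yb g_cont g_mono])
  moreover have "\<bar>(\<theta> b - \<theta> y) - \<omega> * total_phase n H \<mu> \<rho> y\<bar> \<le> 2 * pi + 4 * pi * real n"
    by (intro medium_state_rotation[OF med \<omega> y0 yb _ \<theta>]) (simp add: b_def)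
  moreover have "\<bar>?h u\<bar> \<le> pi / 2" for u
    unfolding halfspace_angle_def using arctan_bounded
    by (metis abs_le_iff less_eq_real_def minus_le_iff)
  ultimately show "\<bar>pi * real (card Z) - \<omega> * total_phase n H \<mu> \<rho> y\<bar> \<le> 4 * pi + 4 * pi * real n"
    unfolding g_def by (smt (verit) field_sum_of_halves)
qed

text \<open>
  Besides the zeros to the right of \<open>y\<close>, the finiteness of all zeros on \<open>[1/C\<^sub>\<infinity>, 1/C\<^sub>0)\<close> enters, because
  \<^const>\<open>branch\<close> enumerates the whole set of wave numbers; it is the same lemma at \<open>y = 1/C\<^sub>\<infinity>\<close>.
\<close>
lemma counting_bounded_error:
  assumes med: "layered_medium n H \<mu> \<rho>" and \<omega>: "\<omega> > 0"
    and slow: "min_speed n \<mu> \<rho> < speed_infinity n \<mu> \<rho>"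
    and y: "1 / speed_infinity n \<mu> \<rho> \<le> y" "y < 1 / min_speed n \<mu> \<rho>"
  shows "\<bar>pi * real (counting n H \<mu> \<rho> \<omega> y) - \<omega> * total_phase n H \<mu> \<rho> y\<bar>
    \<le> 4 * pi + 4 * pi * real n"
proof -
  let ?b = "1 / min_speed n \<mu> \<rho>" and ?a = "1 / speed_infinity n \<mu> \<rho>"
  define Z where "Z z = {u \<in> {z..<?b}. dispersion n H \<mu> \<rho> \<omega> (\<omega> * u) = 0}" for z
  have W: "{k \<in> wavenumbers n H \<mu> \<rho> \<omega>. \<omega> * z \<le> k} = (\<lambda>u. \<omega> * u) ` Z z" if "?a \<le> z" for z
  proof (intro set_eqI iffI)
    fix k assume "k \<in> {k \<in> wavenumbers n H \<mu> \<rho> \<omega>. \<omega> * z \<le> k}"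
    then have "k / \<omega> \<in> Z z" "k = \<omega> * (k / \<omega>)"
      using \<omega> by (auto simp: Z_def wavenumbers_def field_simps)
    then show "k \<in> (\<lambda>u. \<omega> * u) ` Z z" by blast
  next
    fix k assume "k \<in> (\<lambda>u. \<omega> * u) ` Z z"
    then obtain u where u: "k = \<omega> * u" "z \<le> u" "u < ?b" "dispersion n H \<mu> \<rho> \<omega> (\<omega> * u) = 0"
      by (auto simp: Z_def)
    have "\<omega> * ?a \<le> \<omega> * u" "\<omega> * z \<le> \<omega> * u" "\<omega> * u < \<omega> * ?b"
      using u \<omega> that by (intro mult_left_mono mult_strict_left_mono; simp)+
    then have "\<omega> / speed_infinity n \<mu> \<rho> \<le> \<omega> * u" "\<omega> * z \<le> \<omega> * u"
        "\<omega> * u < \<omega> / min_speed n \<mu> \<rho>"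
      by (simp_all only: times_divide_eq_right mult_1_right)
    with u show "k \<in> {k \<in> wavenumbers n H \<mu> \<rho> \<omega>. \<omega> * z \<le> k}"
      unfolding wavenumbers_def by auto
  qed
  have "?a < ?b" using y by simp
  then have "finite (Z ?a)"
    unfolding Z_def by (intro dispersion_zeros_count(1)[OF med \<omega>]) auto
  moreover have "wavenumbers n H \<mu> \<rho> \<omega> = {k \<in> wavenumbers n H \<mu> \<rho> \<omega>. \<omega> * ?a \<le> k}"
    by (auto simp: wavenumbers_def)
  ultimately have "finite (wavenumbers n H \<mu> \<rho> \<omega>)" using W[of ?a] by simp
  then have "counting n H \<mu> \<rho> \<omega> y = card (Z y)"
    using \<omega> by (simp add: counting_eq_card W[OF y(1)] card_image inj_on_def)
  then show ?thesis
    unfolding Z_def using dispersion_zeros_count(2)[OF med \<omega> y] by simp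
qed

section \<open>Layers singled out by the ordering of the speeds\<close>

lemma speed_ordering_facts:
  assumes "speed_ordering n \<mu> \<rho> \<sigma>" "n \<ge> 1"
    and "min_speed n \<mu> \<rho> < speed_infinity n \<mu> \<rho>"
  shows "wave_speed \<mu> \<rho> (\<sigma> 1) = min_speed n \<mu> \<rho>"
    and "\<sigma> 1 \<in> {1..n}" and "\<sigma> 2 \<in> {1..n+1}" and "\<sigma> 2 \<noteq> \<sigma> 1"
    and "\<And>j. j \<in> {1..n+1} \<Longrightarrow> j \<noteq> \<sigma> 1 \<Longrightarrow> wave_speed \<mu> \<rho> (\<sigma> 2) \<le> wave_speed \<mu> \<rho> j"
proof -
  have perm: "\<sigma> permutes {1..n+1}"
    and mono: "\<And>i j. i \<in> {1..n+1} \<Longrightarrow> j \<in> {1..n+1} \<Longrightarrow> i \<le> j \<Longrightarrow>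
      wave_speed \<mu> \<rho> (\<sigma> i) \<le> wave_speed \<mu> \<rho> (\<sigma> j)"
    using assms(1) by (auto simp: speed_ordering_def mono_on_def)
  have onto: "\<exists>i\<in>{1..n+1}. j = \<sigma> i" if "j \<in> {1..n+1}" for j
    using permutes_image[OF perm] that by (metis imageE)
  have \<sigma>1: "\<sigma> 1 \<in> {1..n+1}" using permutes_in_image[OF perm, of 1] by simp
  show \<sigma>2: "\<sigma> 2 \<in> {1..n+1}" using permutes_in_image[OF perm, of 2] assms(2) by simp
  show "\<sigma> 2 \<noteq> \<sigma> 1" using permutes_inj[OF perm] by (metis injD one_eq_numeral_iff num.distinct(1))
  obtain j where "j \<in> {1..n+1}" "min_speed n \<mu> \<rho> = wave_speed \<mu> \<rho> j"
    using min_speed_attained by blast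
  then obtain i where i: "i \<in> {1..n+1}" "min_speed n \<mu> \<rho> = wave_speed \<mu> \<rho> (\<sigma> i)"
    using onto by blast
  have "wave_speed \<mu> \<rho> (\<sigma> 1) \<le> min_speed n \<mu> \<rho>"
    unfolding i(2) using i(1) by (intro mono) auto
  moreover have "min_speed n \<mu> \<rho> \<le> wave_speed \<mu> \<rho> (\<sigma> 1)"
    using \<sigma>1 by (intro min_speed_le) auto
  ultimately show C: "wave_speed \<mu> \<rho> (\<sigma> 1) = min_speed n \<mu> \<rho>" by simp
  have "\<sigma> 1 \<noteq> n + 1"
  proof
    assume "\<sigma> 1 = n + 1"
    with C assms(3) show False by (simp add: speed_infinity_def)
  qed
  then show "\<sigma> 1 \<in> {1..n}" using \<sigma>1 by auto
  fix j assume j: "j \<in> {1..n+1}" "j \<noteq> \<sigma> 1"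
  then obtain i where i: "i \<in> {1..n+1}" "j = \<sigma> i" using onto by blast
  with j have "i \<noteq> 1" by auto
  with i have "2 \<le> i" by auto
  then show "wave_speed \<mu> \<rho> (\<sigma> 2) \<le> wave_speed \<mu> \<rho> j"
    unfolding i(2) using i(1) by (intro mono) auto
qed

text \<open>
  The bounded error is negligible because the slowest layer oscillates for every \<open>y < 1/C\<^sub>0\<close>; it is not
  the half-space, so it belongs to the sum and makes the total phase positive.
\<close>
lemma counting_asymp_equiv_total_phase:
  assumes med: "layered_medium n H \<mu> \<rho>"
    and slow: "min_speed n \<mu> \<rho> < speed_infinity n \<mu> \<rho>"
    and y: "1 / speed_infinity n \<mu> \<rho> \<le> y" "y < 1 / min_speed n \<mu> \<rho>"
  shows "(\<lambda>\<omega>. real (counting n H \<mu> \<rho> \<omega> y)) \<sim>[at_top] (\<lambda>\<omega>. \<omega> / pi * total_phase n H \<mu> \<rho> y)"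
proof (rule asymp_equiv_linear)
  show "\<bar>pi * real (counting n H \<mu> \<rho> \<omega> y) - \<omega> * total_phase n H \<mu> \<rho> y\<bar>
      \<le> 4 * pi + 4 * pi * real n" if "\<omega> > 0" for \<omega>
    by (rule counting_bounded_error[OF med that slow y])
  obtain j where j: "j \<in> {1..n+1}" "min_speed n \<mu> \<rho> = wave_speed \<mu> \<rho> j"
    using min_speed_attained by blast
  moreover have "j \<noteq> n + 1" using j(2) slow by (auto simp: speed_infinity_def)
  ultimately have jn: "j \<in> {1..n}" by auto
  have "speed_infinity n \<mu> \<rho> > 0"
    using wave_speed_pos[OF med, of "n+1"] by (simp add: speed_infinity_def)
  then have y0: "y > 0" using y(1) by (meson less_le_trans zero_less_divide_1_iff)
  have pos: "layer_phase H \<mu> \<rho> j y > 0" if "j \<in> {1..n}" "y < 1 / wave_speed \<mu> \<rho> j" for j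
  proof -
    have "y\<^sup>2 < (1 / wave_speed \<mu> \<rho> j)\<^sup>2"
      using that y0 by (intro power_strict_mono) auto
    then have "nu_bar \<mu> \<rho> j y \<noteq> 0" by (simp add: nu_bar_def branch_sqrt_def power_one_over)
    then show ?thesis using layer_thickness_pos[OF med] that by (simp add: layer_phase_def)
  qed
  show "total_phase n H \<mu> \<rho> y > 0"
    unfolding total_phase_def
    by (rule sum_pos) (use pos jn j(2) y(2) in auto)
qed

lemma total_phase_one_slow_layer:
  assumes "layered_medium n H \<mu> \<rho>"
    and slow: "min_speed n \<mu> \<rho> < speed_infinity n \<mu> \<rho>"
    and ord: "speed_ordering n \<mu> \<rho> \<sigma>"
    and y: "1 / wave_speed \<mu> \<rho> (\<sigma> 2) \<le> y" "y < 1 / min_speed n \<mu> \<rho>"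
  shows "total_phase n H \<mu> \<rho> y = layer_phase H \<mu> \<rho> (\<sigma> 1) y"
proof -
  have "n \<ge> 1" using assms(1) by (simp add: layered_medium_def)
  note \<sigma> = speed_ordering_facts[OF ord this slow]
  have "1 / wave_speed \<mu> \<rho> j \<le> y" if "j \<in> {1..n}" "j \<noteq> \<sigma> 1" for j
  proof -
    have "wave_speed \<mu> \<rho> (\<sigma> 2) > 0" using wave_speed_pos[OF assms(1)] \<sigma>(3) by auto
    moreover have "wave_speed \<mu> \<rho> (\<sigma> 2) \<le> wave_speed \<mu> \<rho> j" using \<sigma>(5) that by auto
    ultimately have "1 / wave_speed \<mu> \<rho> j \<le> 1 / wave_speed \<mu> \<rho> (\<sigma> 2)"
      by (intro divide_left_mono) auto
    with y(1) show ?thesis by simp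
  qed
  then have "{j. j \<in> {1..n} \<and> y < 1 / wave_speed \<mu> \<rho> j} = {\<sigma> 1}"
    using \<sigma>(1,2) y(2) by force
  then show ?thesis by (simp add: total_phase_def)
qed

text \<open>
  The layer \<open>\<sigma>(2)\<close> is slower than the half-space here, so \<open>\<sigma>(1)\<close> and \<open>\<sigma>(2)\<close> are the two finite
  layers.
\<close>
lemma total_phase_two_layers:
  assumes "layered_medium 2 H \<mu> \<rho>"
    and slow: "min_speed 2 \<mu> \<rho> < speed_infinity 2 \<mu> \<rho>"
    and ord: "speed_ordering 2 \<mu> \<rho> \<sigma>"
    and y: "1 / speed_infinity 2 \<mu> \<rho> \<le> y" "y < 1 / wave_speed \<mu> \<rho> (\<sigma> 2)" "y < 1 / min_speed 2 \<mu> \<rho>"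
  shows "total_phase 2 H \<mu> \<rho> y = layer_phase H \<mu> \<rho> (\<sigma> 1) y + layer_phase H \<mu> \<rho> (\<sigma> 2) y"
proof -
  note \<sigma> = speed_ordering_facts[OF ord _ slow, simplified]
  have "\<sigma> 2 \<noteq> 3"
  proof
    assume "\<sigma> 2 = 3"
    then have "speed_infinity 2 \<mu> \<rho> = wave_speed \<mu> \<rho> (\<sigma> 2)" by (simp add: speed_infinity_def)
    with y(1,2) show False by simp
  qed
  then have "{1..2} = {\<sigma> 1, \<sigma> 2}" using \<sigma>(2-4) by auto
  then have "{j. j \<in> {1..2} \<and> y < 1 / wave_speed \<mu> \<rho> j} = {\<sigma> 1, \<sigma> 2}"
    using \<sigma>(1) y(2,3) by auto
  then show ?thesis using \<sigma>(4) by (simp add: total_phase_def)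
qed

theorem proposition1p5:
  fixes n :: nat and H :: "nat \<Rightarrow> ereal" and \<mu> \<rho> :: "nat \<Rightarrow> real" and \<sigma> :: "nat \<Rightarrow> nat"
  assumes "layered_medium n H \<mu> \<rho>"
    and "min_speed n \<mu> \<rho> < speed_infinity n \<mu> \<rho>"
    and "speed_ordering n \<mu> \<rho> \<sigma>"
  shows
    "(n = 1 \<longrightarrow>
       (\<forall>y\<in>{1 / speed_infinity n \<mu> \<rho> ..< 1 / min_speed n \<mu> \<rho>}.
          (\<lambda>\<omega>. real (counting n H \<mu> \<rho> \<omega> y)) \<sim>[at_top]
          (\<lambda>\<omega>. \<omega> / pi * layer_phase H \<mu> \<rho> (\<sigma> 1) y)))
     \<and>
     (n = 2 \<longrightarrow>
       (\<forall>y\<in>{1 / speed_infinity n \<mu> \<rho> ..< 1 / min_speed n \<mu> \<rho>}.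
          (y \<in> {1 / wave_speed \<mu> \<rho> (\<sigma> 2) ..< 1 / min_speed n \<mu> \<rho>} \<longrightarrow>
             (\<lambda>\<omega>. real (counting n H \<mu> \<rho> \<omega> y)) \<sim>[at_top]
             (\<lambda>\<omega>. \<omega> / pi * layer_phase H \<mu> \<rho> (\<sigma> 1) y)) \<and>
          (y \<in> {1 / speed_infinity n \<mu> \<rho> ..< 1 / wave_speed \<mu> \<rho> (\<sigma> 2)} \<longrightarrow>
             (\<lambda>\<omega>. real (counting n H \<mu> \<rho> \<omega> y)) \<sim>[at_top]
             (\<lambda>\<omega>. \<omega> / pi * (layer_phase H \<mu> \<rho> (\<sigma> 1) y + layer_phase H \<mu> \<rho> (\<sigma> 2) y)))))
     \<and>
     (3 \<le> n \<and> min_speed n \<mu> \<rho> < wave_speed \<mu> \<rho> (\<sigma> 2) \<longrightarrow>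
       (\<forall>y\<in>{1 / wave_speed \<mu> \<rho> (\<sigma> 2) ..< 1 / min_speed n \<mu> \<rho>}.
          (\<lambda>\<omega>. real (counting n H \<mu> \<rho> \<omega> y)) \<sim>[at_top]
          (\<lambda>\<omega>. \<omega> / pi * layer_phase H \<mu> \<rho> (\<sigma> 1) y)))"
proof -
  have n: "n \<ge> 1" using assms(1) by (simp add: layered_medium_def)
  note \<sigma> = speed_ordering_facts[OF assms(3) n assms(2)]
  have fast: "wave_speed \<mu> \<rho> (\<sigma> 2) \<le> speed_infinity n \<mu> \<rho>"
    unfolding speed_infinity_def using \<sigma>(2) by (intro \<sigma>(5)) auto
  have "wave_speed \<mu> \<rho> (\<sigma> 2) > 0" using wave_speed_pos[OF assms(1)] \<sigma>(3) by auto
  then have inf: "1 / speed_infinity n \<mu> \<rho> \<le> 1 / wave_speed \<mu> \<rho> (\<sigma> 2)"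
    using fast by (intro divide_left_mono) auto
  have one: "(\<lambda>\<omega>. real (counting n H \<mu> \<rho> \<omega> y)) \<sim>[at_top]
      (\<lambda>\<omega>. \<omega> / pi * layer_phase H \<mu> \<rho> (\<sigma> 1) y)"
    if "y \<in> {1 / wave_speed \<mu> \<rho> (\<sigma> 2)..<1 / min_speed n \<mu> \<rho>}" for y
    using counting_asymp_equiv_total_phase[OF assms(1,2), of y]
      total_phase_one_slow_layer[OF assms, of y] that inf by simp
  have two: "(\<lambda>\<omega>. real (counting n H \<mu> \<rho> \<omega> y)) \<sim>[at_top]
      (\<lambda>\<omega>. \<omega> / pi * (layer_phase H \<mu> \<rho> (\<sigma> 1) y + layer_phase H \<mu> \<rho> (\<sigma> 2) y))"
    if "n = 2" "y \<in> {1 / speed_infinity n \<mu> \<rho>..<1 / min_speed n \<mu> \<rho>}"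
      "y \<in> {1 / speed_infinity n \<mu> \<rho>..<1 / wave_speed \<mu> \<rho> (\<sigma> 2)}" for y
    using counting_asymp_equiv_total_phase[OF assms(1,2), of y]
      total_phase_two_layers[of H \<mu> \<rho> \<sigma> y] assms that by simp
  \<comment> \<open>For a single layer the second speed is that of the half-space, so every admissible \<open>y\<close> is covered by \<open>one\<close>.\<close>
  have half: "speed_infinity n \<mu> \<rho> = wave_speed \<mu> \<rho> (\<sigma> 2)" if "n = 1"
  proof -
    have "\<sigma> 2 = 2" using \<sigma>(2-4) that by auto
    then show ?thesis using that by (simp add: speed_infinity_def numeral_2_eq_2)
  qed
  show ?thesis using one two half by auto
qed

end
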